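(* Let $(M,\Lambda)$ be an $m$-dimensional Nambu-Poisson manifold of order $n$, with $n\geq 3$. Then the center of the Leibniz algebra $(\Omega^{n-1}(M),[\![\;,\;]\!])$, that is, $$Z(\Omega^{n-1}(M))=\{\alpha\in\Omega^{n-1}(M)\;:\;[\![\alpha,\beta]\!]=0\ \text{ for all }\beta\in\Omega^{n-1}(M)\},$$ is the $C^\infty(M,\mathbb{R})$-module $$\ker\#_{n-1}=\{\alpha\in\Omega^{n-1}(M)\;:\;\#_{n-1}(\alpha)=0\}.$$
   Context: All manifolds are smooth and connected. $\Omega^k(M)$ denotes the space of $k$-forms and $\mathcal{V}^k(M)$ the space of $k$-vector fields on $M$. A Nambu-Poisson manifold of order $n$ (with $n\le m=\dim M$) is a pair $(M,\Lambda)$ where $\Lambda\in\mathcal{V}^n(M)$ is such that the bracket $\{f_1,\dots,f_n\}=\Lambda(df_1,\dots,df_n)$ satisfies the fundamental identity $$\{f_1,\dots,f_{n-1},\{g_1,\dots,g_n\}\}=\sum_{i=1}^n\{g_1,\dots,\{f_1,\dots,f_{n-1},g_i\},\dots,g_n\}$$ for all $f_1,\dots,f_{n-1},g_1,\dots,g_n\in C^\infty(M,\mathbb{R})$. For $k\le n$, $\#_k:\Omega^k(M)\to\mathcal{V}^{n-k}(M)$ is $\#_k(\beta)=i(\beta)\Lambda$, where contraction of a multivector by a form is in the first slots: $i(\alpha_1\wedge\dots\wedge\alpha_k)P=P(\alpha_1,\dots,\alpha_k,\cdot,\dots,\cdot)$ for 1-forms $\alpha_i$. The bracket on $\Omega^{n-1}(M)$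 is $[\![\alpha,\beta]\!]=\mathcal{L}_{\#_{n-1}(\alpha)}\beta+(-1)^n\,\#_n(d\alpha)\,\beta$, where $\mathcal{L}$ is the Lie derivative and $\#_n(d\alpha)=i(d\alpha)\Lambda\in C^\infty(M,\mathbb{R})$. It is known to make $\Omega^{n-1}(M)$ a (left) Leibniz algebra: $[\![a_1,[\![a_2,a_3]\!]]\!]=[\![[\![a_1,a_2]\!],a_3]\!]+[\![a_2,[\![a_1,a_3]\!]]\!]$. *)

theory Defs
  imports "HOL-Analysis.Analysis" "HOL-Algebra.Module"
begin

section \<open>Smooth manifolds\<close>

text \<open>The predicates \<open>Ck_on\<close> and \<open>smooth_on\<close> are meant for open \<open>S\<close>.\<close>

primrec Ck_on ::
  "nat \<Rightarrow> 'e::real_normed_vector set \<Rightarrow> ('e \<Rightarrow> 'f::real_normed_vector) \<Rightarrow> bool" where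
  "Ck_on 0 S f \<longleftrightarrow> continuous_on S f"
| "Ck_on (Suc k) S f \<longleftrightarrow>
     (\<forall>x\<in>S. f differentiable (at x)) \<and>
     (\<forall>v. Ck_on k S (\<lambda>x. frechet_derivative f (at x) v))"

definition smooth_on ::
  "'e::real_normed_vector set \<Rightarrow> ('e \<Rightarrow> 'f::real_normed_vector) \<Rightarrow> bool" where
  "smooth_on S f \<longleftrightarrow> (\<forall>k. Ck_on k S f)"

text \<open>
  A chart \<open>(U, x)\<close> consists of its domain and its coordinate map. The map is a total function,
  whose values outside of \<open>U\<close> are irrelevant.
\<close>

type_synonym ('a, 'e) chart = "'a set \<times> ('a \<Rightarrow> 'e)"

abbreviation chart_dom :: "('a, 'e) chart \<Rightarrow> 'a set" where
  "chart_dom c \<equiv> fst c"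

abbreviation chart_image :: "('a, 'e) chart \<Rightarrow> 'e set" where
  "chart_image c \<equiv> snd c ` fst c"

definition chart_inv :: "('a, 'e) chart \<Rightarrow> 'e \<Rightarrow> 'a" where
  "chart_inv c = inv_into (fst c) (snd c)"

definition is_chart :: "'a topology \<Rightarrow> ('a, 'e::euclidean_space) chart \<Rightarrow> bool" where
  "is_chart M c \<longleftrightarrow>
     openin M (chart_dom c) \<and> open (chart_image c) \<and>
     homeomorphic_map (subtopology M (chart_dom c)) (top_of_set (chart_image c)) (snd c)"

text \<open>
  A connected smooth manifold of dimension \<open>DIM('e)\<close>, given by its topology and a smooth atlas,
  which need not be maximal.
\<close>

definition smooth_manifold :: "'a topology \<Rightarrow> ('a, 'e::euclidean_space) chart set \<Rightarrow> bool" where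
  "smooth_manifold M A \<longleftrightarrow>
     Hausdorff_space M \<and> second_countable M \<and> connected_space M \<and>
     (\<forall>c\<in>A. is_chart M c) \<and> (\<Union>c\<in>A. chart_dom c) = topspace M \<and>
     (\<forall>c\<in>A. \<forall>c'\<in>A.
        smooth_on (snd c ` (chart_dom c \<inter> chart_dom c')) (snd c' \<circ> chart_inv c))"

text \<open>
  The algebra of smooth functions. Functions on the manifold are extended by \<open>0\<close> to the whole
  type, so that they are determined by their values on the manifold.
\<close>

definition smooth_functions ::
  "'a topology \<Rightarrow> ('a, 'e::euclidean_space) chart set \<Rightarrow> ('a \<Rightarrow> real) set" where
  "smooth_functions M A =
     {h. (\<forall>c\<in>A. smooth_on (chart_image c) (h \<circ> chart_inv c)) \<and> (\<forall>p. p \<notin> topspace M \<longrightarrow> h p = 0)}"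

definition smooth_function_ring ::
  "'a topology \<Rightarrow> ('a, 'e::euclidean_space) chart set \<Rightarrow> ('a \<Rightarrow> real) ring" where
  "smooth_function_ring M A =
     \<lparr>carrier = smooth_functions M A,
      monoid.mult = (\<lambda>g h p. g p * h p),
      one = (\<lambda>p. if p \<in> topspace M then 1 else 0),
      zero = (\<lambda>p. 0),
      add = (\<lambda>g h p. g p + h p)\<rparr>"

section \<open>Differential forms and multivector fields\<close>

text \<open>Alternating multilinear maps in \<open>k\<close> arguments, extended by \<open>0\<close> to lists of other lengths.\<close>

definition alt_multilinear :: "nat \<Rightarrow> ('v::real_vector list \<Rightarrow> real) \<Rightarrow> bool" where
  "alt_multilinear k F \<longleftrightarrow>
     (\<forall>vs. length vs \<noteq> k \<longrightarrow> F vs = 0) \<and>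
     (\<forall>vs i. length vs = k \<longrightarrow> i < k \<longrightarrow> linear (\<lambda>v. F (vs[i := v]))) \<and>
     (\<forall>vs i j. length vs = k \<longrightarrow> i < j \<longrightarrow> j < k \<longrightarrow> vs ! i = vs ! j \<longrightarrow> F vs = 0)"

text \<open>
  The tangent space at \<open>p\<close> is represented by a copy of \<open>'e\<close> for each chart \<open>c\<close> around \<open>p\<close>, the copies
  being identified by the derivatives \<open>transition c c' p\<close> of the coordinate changes. The cotangent
  space is likewise represented by copies of the dual space of \<open>'e\<close>. A field of alternating
  tensors is hence a family of local representatives \<open>F c p\<close>, indexed by the charts \<open>c\<close> of the atlas
  and the points \<open>p\<close> in the domain of \<open>c\<close>, which obeys the transformation law. It is extended by
  \<open>0\<close> to all other \<open>c\<close> and \<open>p\<close>.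
\<close>

type_synonym ('a, 'e, 'v) field = "('a, 'e) chart \<Rightarrow> 'a \<Rightarrow> 'v list \<Rightarrow> real"

definition transition ::
  "('a, 'e::euclidean_space) chart \<Rightarrow> ('a, 'e) chart \<Rightarrow> 'a \<Rightarrow> 'e \<Rightarrow>\<^sub>L 'e" where
  "transition c c' p = Blinfun (frechet_derivative (snd c' \<circ> chart_inv c) (at (snd c p)))"

text \<open>The argument \<open>T c c' p\<close> transforms tensor arguments from the chart \<open>c\<close> to the chart \<open>c'\<close>.\<close>

definition alt_fields ::
  "('a, 'e::euclidean_space) chart set \<Rightarrow>
   (('a, 'e) chart \<Rightarrow> ('a, 'e) chart \<Rightarrow> 'a \<Rightarrow> 'v \<Rightarrow> 'v::real_vector) \<Rightarrow>
   nat \<Rightarrow> ('a, 'e, 'v) field set" where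
  "alt_fields A T k =
     {F. (\<forall>c p. c \<in> A \<and> p \<in> chart_dom c \<longrightarrow> alt_multilinear k (F c p)) \<and>
         (\<forall>c p. \<not> (c \<in> A \<and> p \<in> chart_dom c) \<longrightarrow> F c p = (\<lambda>vs. 0)) \<and>
         (\<forall>c\<in>A. \<forall>c'\<in>A. \<forall>p \<in> chart_dom c \<inter> chart_dom c'. \<forall>vs.
            F c p vs = F c' p (map (T c c' p) vs)) \<and>
         (\<forall>c\<in>A. \<forall>vs. smooth_on (chart_image c) (\<lambda>x. F c (chart_inv c x) vs))}"

definition forms ::
  "('a, 'e::euclidean_space) chart set \<Rightarrow> nat \<Rightarrow> ('a, 'e, 'e) field set" where
  "forms A k = alt_fields A (\<lambda>c c' p. blinfun_apply (transition c c' p)) k"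

definition multivectors ::
  "('a, 'e::euclidean_space) chart set \<Rightarrow> nat \<Rightarrow> ('a, 'e, 'e \<Rightarrow>\<^sub>L real) field set" where
  "multivectors A k = alt_fields A (\<lambda>c c' p a. a o\<^sub>L transition c' c p) k"

abbreviation zero_field :: "('a, 'e, 'v) field" where
  "zero_field \<equiv> (\<lambda>c p vs. 0)"

text \<open>Only the additive structure and the scalar multiplication of this record are relevant.\<close>

definition form_module ::
  "('a, 'e::euclidean_space) chart set \<Rightarrow> nat \<Rightarrow> ('a \<Rightarrow> real, ('a, 'e, 'e) field) module" where
  "form_module A k =
     \<lparr>carrier = forms A k,
      monoid.mult = undefined,
      one = undefined,
      zero = zero_field,
      add = (\<lambda>\<alpha> \<beta> c p vs. \<alpha> c p vs + \<beta> c p vs),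
      smult = (\<lambda>h \<alpha> c p vs. h p * \<alpha> c p vs)\<rparr>"

section \<open>Operations on fields\<close>

text \<open>
  The contraction \<open>i(\<beta>)P\<close> of an alternating map \<open>P\<close> on covectors by an alternating \<open>k\<close>-form \<open>\<beta>\<close>
  is linear in \<open>\<beta>\<close> and satisfies
  \<open>i(\<alpha>\<^sub>1 \<and> \<dots> \<and> \<alpha>\<^sub>k)P = P(\<alpha>\<^sub>1, \<dots>, \<alpha>\<^sub>k, \<cdot>, \<dots>, \<cdot>)\<close>, see \<open>contract_wedge\<close> below. The formula results
  from \<open>\<beta> = 1/k! \<Sum> \<beta>(b\<^sub>1, \<dots>, b\<^sub>k) b\<^sub>1\<^sup>* \<and> \<dots> \<and> b\<^sub>k\<^sup>*\<close>, the sum being over all \<open>k\<close>-tuples of basis vectors.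
\<close>

definition contract ::
  "nat \<Rightarrow> ('e::euclidean_space list \<Rightarrow> real) \<Rightarrow> (('e \<Rightarrow>\<^sub>L real) list \<Rightarrow> real) \<Rightarrow>
   ('e \<Rightarrow>\<^sub>L real) list \<Rightarrow> real" where
  "contract k \<beta> P as =
     (\<Sum>bs | set bs \<subseteq> Basis \<and> length bs = k. \<beta> bs * P (map blinfun_inner_left bs @ as)) / fact k"

definition sharp ::
  "nat \<Rightarrow> ('a, 'e::euclidean_space, 'e \<Rightarrow>\<^sub>L real) field \<Rightarrow> ('a, 'e, 'e) field \<Rightarrow>
   ('a, 'e, 'e \<Rightarrow>\<^sub>L real) field" where
  "sharp k \<Lambda> \<beta> = (\<lambda>c p. contract k (\<beta> c p) (\<Lambda> c p))"

text \<open>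
  The components of a \<open>1\<close>-vector field in the chart \<open>c\<close>, that is, the identification of the double
  dual of the tangent space with the tangent space.
\<close>

definition vector_at ::
  "('a, 'e::euclidean_space, 'e \<Rightarrow>\<^sub>L real) field \<Rightarrow> ('a, 'e) chart \<Rightarrow> 'a \<Rightarrow> 'e" where
  "vector_at X c p = (\<Sum>b\<in>Basis. X c p [blinfun_inner_left b] *\<^sub>R b)"

text \<open>The derivative of \<open>h\<close> at the point \<open>p\<close> in the coordinates of the chart \<open>c\<close>.\<close>

definition chart_deriv ::
  "('a, 'e::euclidean_space) chart \<Rightarrow> ('a \<Rightarrow> 'f::real_normed_vector) \<Rightarrow> 'a \<Rightarrow> 'e \<Rightarrow> 'f" where
  "chart_deriv c h p = frechet_derivative (h \<circ> chart_inv c) (at (snd c p))"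

text \<open>
  Exterior derivative and Lie derivative of a form, evaluated on vectors with constant
  coefficients in a chart. For such a vector field \<open>v\<close> we have \<open>[X, v] = - DX v\<close>, so the formula
  \<open>(\<L>\<^sub>X \<beta>)(v\<^sub>1, \<dots>, v\<^sub>k) = X(\<beta>(v\<^sub>1, \<dots>, v\<^sub>k)) - \<Sum>\<^sub>i \<beta>(v\<^sub>1, \<dots>, [X, v\<^sub>i], \<dots>, v\<^sub>k)\<close> becomes the one below.
\<close>

definition ext_deriv :: "('a, 'e::euclidean_space, 'e) field \<Rightarrow> ('a, 'e, 'e) field" where
  "ext_deriv \<alpha> = (\<lambda>c p vs. if p \<in> chart_dom c then
     (\<Sum>i<length vs. (-1) ^ i *
        chart_deriv c (\<lambda>q. \<alpha> c q (take i vs @ drop (Suc i) vs)) p (vs ! i)) else 0)"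

definition lie_deriv ::
  "('a, 'e::euclidean_space, 'e \<Rightarrow>\<^sub>L real) field \<Rightarrow> ('a, 'e, 'e) field \<Rightarrow> ('a, 'e, 'e) field" where
  "lie_deriv X \<beta> = (\<lambda>c p vs. if p \<in> chart_dom c then
     chart_deriv c (\<lambda>q. \<beta> c q vs) p (vector_at X c p) +
     (\<Sum>i<length vs. \<beta> c p (vs[i := chart_deriv c (vector_at X c) p (vs ! i)])) else 0)"

section \<open>Nambu-Poisson manifolds\<close>

definition differential ::
  "('a, 'e::euclidean_space) chart \<Rightarrow> ('a \<Rightarrow> real) \<Rightarrow> 'a \<Rightarrow> 'e \<Rightarrow>\<^sub>L real" where
  "differential c h p = Blinfun (chart_deriv c h p)"

text \<open>
  The function \<open>\<Lambda>(df\<^sub>1, \<dots>, df\<^sub>n)\<close>. By the transformation law, its value at \<open>p\<close> does not depend on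
  the chart around \<open>p\<close> in which it is computed.
\<close>

definition nambu_bracket ::
  "'a topology \<Rightarrow> ('a, 'e::euclidean_space) chart set \<Rightarrow> ('a, 'e, 'e \<Rightarrow>\<^sub>L real) field \<Rightarrow>
   ('a \<Rightarrow> real) list \<Rightarrow> 'a \<Rightarrow> real" where
  "nambu_bracket M A \<Lambda> fs = (\<lambda>p. if p \<in> topspace M then
     (let c = (SOME c. c \<in> A \<and> p \<in> chart_dom c) in \<Lambda> c p (map (\<lambda>f. differential c f p) fs))
     else 0)"

definition nambu_poisson_manifold ::
  "'a topology \<Rightarrow> ('a, 'e::euclidean_space) chart set \<Rightarrow> nat \<Rightarrow>
   ('a, 'e, 'e \<Rightarrow>\<^sub>L real) field \<Rightarrow> bool" where
  "nambu_poisson_manifold M A n \<Lambda> \<longleftrightarrow>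
     smooth_manifold M A \<and> 1 \<le> n \<and> n \<le> DIM('e) \<and> \<Lambda> \<in> multivectors A n \<and>
     (\<forall>fs gs. set fs \<subseteq> smooth_functions M A \<and> length fs = n - 1 \<and>
              set gs \<subseteq> smooth_functions M A \<and> length gs = n \<longrightarrow>
        (\<forall>p\<in>topspace M.
           nambu_bracket M A \<Lambda> (fs @ [nambu_bracket M A \<Lambda> gs]) p =
           (\<Sum>i<n. nambu_bracket M A \<Lambda> (gs[i := nambu_bracket M A \<Lambda> (fs @ [gs ! i])]) p)))"

definition leibniz_bracket ::
  "nat \<Rightarrow> ('a, 'e::euclidean_space, 'e \<Rightarrow>\<^sub>L real) field \<Rightarrow>
   ('a, 'e, 'e) field \<Rightarrow> ('a, 'e, 'e) field \<Rightarrow> ('a, 'e, 'e) field" where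
  "leibniz_bracket n \<Lambda> \<alpha> \<beta> = (\<lambda>c p vs.
     lie_deriv (sharp (n - 1) \<Lambda> \<alpha>) \<beta> c p vs +
     (-1) ^ n * sharp n \<Lambda> (ext_deriv \<alpha>) c p [] * \<beta> c p vs)"

definition leibniz_center ::
  "('a, 'e::euclidean_space) chart set \<Rightarrow> nat \<Rightarrow> ('a, 'e, 'e \<Rightarrow>\<^sub>L real) field \<Rightarrow>
   ('a, 'e, 'e) field set" where
  "leibniz_center A n \<Lambda> =
     {\<alpha> \<in> forms A (n - 1). \<forall>\<beta> \<in> forms A (n - 1). leibniz_bracket n \<Lambda> \<alpha> \<beta> = zero_field}"

definition sharp_kernel ::
  "('a, 'e::euclidean_space) chart set \<Rightarrow> nat \<Rightarrow> ('a, 'e, 'e \<Rightarrow>\<^sub>L real) field \<Rightarrow>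
   ('a, 'e, 'e) field set" where
  "sharp_kernel A k \<Lambda> = {\<alpha> \<in> forms A k. sharp k \<Lambda> \<alpha> = zero_field}"

section \<open>The contraction of a decomposable form\<close>

definition wedge :: "('e::euclidean_space \<Rightarrow>\<^sub>L real) list \<Rightarrow> 'e list \<Rightarrow> real" where
  "wedge as vs = (if length vs = length as then
     (\<Sum>\<sigma> | \<sigma> permutes {..<length as}.
        of_int (sign \<sigma>) * (\<Prod>i<length as. blinfun_apply (as ! i) (vs ! \<sigma> i))) else 0)"

lemma alt_multilinear_swap:
  assumes F: "alt_multilinear k F" and l: "length vs = k" and ij: "i < k" "j < k" "i \<noteq> j"
  shows "F (vs[i := vs ! j, j := vs ! i]) = - F vs"
proof -
  have lin: "linear (\<lambda>v. F (us[m := v]))" if "length us = k" "m < k" for us m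
    using F that unfolding alt_multilinear_def by blast
  have alt: "F us = 0" if "length us = k" "a < k" "b < k" "a \<noteq> b" "us ! a = us ! b" for us a b
    using F that unfolding alt_multilinear_def by (metis linorder_neqE_nat)
  define G where "G x y = F (vs[i := x, j := y])" for x y
  have 1: "G x (y + z) = G x y + G x z" for x y z
    unfolding G_def using linear_add[OF lin[of "vs[i := x]" j]] l ij by simp
  have 2: "G (x + y) z = G x z + G y z" for x y z
    unfolding G_def using linear_add[OF lin[of "vs[j := z]" i]] l ij
    by (simp add: list_update_swap)
  have 3: "G x x = 0" for x
    unfolding G_def using l ij by (intro alt[of _ i j]) auto
  let ?x = "vs ! i" and ?y = "vs ! j"
  have "G (?x + ?y) (?x + ?y) = G ?x ?x + G ?x ?y + (G ?y ?x + G ?y ?y)"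
    by (simp only: 1 2 add_ac)
  hence "G ?y ?x = - G ?x ?y" by (simp add: 3)
  thus ?thesis unfolding G_def by (simp add: l)
qed

lemma alt_multilinear_permute:
  assumes F: "alt_multilinear k F" and l: "length us = m" "length us + length ws = k"
    and s: "\<sigma> permutes {..<m}"
  shows "F (map (\<lambda>i. us ! \<sigma> i) [0..<m] @ ws) = of_int (sign \<sigma>) * F (us @ ws)"
proof -
  have "\<forall>us. length us = m \<and> length us + length ws = k \<longrightarrow>
      F (map (\<lambda>i. us ! \<sigma> i) [0..<m] @ ws) = of_int (sign \<sigma>) * F (us @ ws)"
    using s finite_lessThan[of m]
  proof (induction rule: permutes_induct)
    case id
    then show ?case by (auto simp: sign_id map_nth)
  next
    case (swap a b p)
    show ?case
    proof (intro allI impI)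
      fix us :: "'a list" assume l: "length us = m \<and> length us + length ws = k"
      have ab: "a < m" "b < m" "a < k" "b < k" "a \<noteq> b" using swap l by auto
      let ?us = "us[a := us ! b, b := us ! a]"
      have perm: "p i < m" if "i < m" for i
        using swap that permutes_in_image by fastforce
      have e1: "map (\<lambda>i. us ! (Transposition.transpose a b \<circ> p) i) [0..<m] = map (\<lambda>i. ?us ! p i) [0..<m]"
        using l ab perm by (auto simp: Transposition.transpose_def nth_list_update)
      have e2: "?us @ ws = (us @ ws)[a := (us @ ws) ! b, b := (us @ ws) ! a]"
        using l ab by (simp add: list_update_append nth_append)
      have "F (map (\<lambda>i. us ! (Transposition.transpose a b \<circ> p) i) [0..<m] @ ws)
          = of_int (sign p) * F (?us @ ws)"
        unfolding e1 using swap.IH l by simp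
      also have "F (?us @ ws) = - F (us @ ws)"
        unfolding e2 using alt_multilinear_swap[OF F] l ab by simp
      also have "of_int (sign p) * - F (us @ ws) = of_int (sign (Transposition.transpose a b \<circ> p)) * F (us @ ws)"
        using swap ab by (simp add: sign_compose sign_swap_id permutation_swap_id
            permutation_permutes[of p] exI[of _ "{..<m}"])
      finally show "F (map (\<lambda>i. us ! (Transposition.transpose a b \<circ> p) i) [0..<m] @ ws)
          = of_int (sign (Transposition.transpose a b \<circ> p)) * F (us @ ws)" .
    qed
  qed
  thus ?thesis using l by simp
qed

lemma alt_multilinear_expand:
  assumes P: "alt_multilinear k P" and l: "length pre + length as + length cs = k"
  shows "P (pre @ as @ cs) = (\<Sum>bs | set bs \<subseteq> Basis \<and> length bs = length as.
    (\<Prod>i<length as. blinfun_apply (as ! i) (bs ! i)) * P (pre @ map blinfun_inner_left bs @ cs))"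
  using l
proof (induction as arbitrary: pre)
  case Nil
  have "{bs. set bs \<subseteq> Basis \<and> length bs = 0} = {[] :: 'a list}" by auto
  then show ?case by simp
next
  case (Cons a as)
  let ?B = "\<lambda>m. {bs :: 'a list. set bs \<subseteq> Basis \<and> length bs = m}"
  let ?d = "blinfun_inner_left :: 'a \<Rightarrow> 'a \<Rightarrow>\<^sub>L real"
  have a: "a = (\<Sum>b\<in>Basis. blinfun_apply a b *\<^sub>R ?d b)"
    by (rule blinfun_euclidean_eqI)
       (auto simp: blinfun.sum_left blinfun.scaleR_left inner_Basis if_distrib cong: if_cong)
  have lin: "linear (\<lambda>v. P ((pre @ a # as @ cs)[length pre := v]))"
  proof -
    have "length (pre @ a # as @ cs) = k" "length pre < k" using Cons.prems by auto
    thus ?thesis using P unfolding alt_multilinear_def by blast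
  qed
  have sc: "P (pre @ (r *\<^sub>R v) # as @ cs) = r * P (pre @ v # as @ cs)" for r v
    using linear_scale[OF lin, of r v] by simp
  have "P (pre @ a # as @ cs)
      = (\<lambda>v. P ((pre @ a # as @ cs)[length pre := v])) (\<Sum>b\<in>Basis. blinfun_apply a b *\<^sub>R ?d b)"
    using a by simp
  also have "\<dots> = (\<Sum>b\<in>Basis. blinfun_apply a b * P (pre @ ?d b # as @ cs))"
    by (subst linear_sum[OF lin]) (simp add: sc)
  also have "\<dots> = (\<Sum>b\<in>Basis. \<Sum>bs\<in>?B (length as). blinfun_apply a b *
      ((\<Prod>i<length as. blinfun_apply (as ! i) (bs ! i)) *
        P (pre @ ?d b # map ?d bs @ cs)))"
    using Cons.IH[of "pre @ [?d b]" for b] Cons.prems by (simp add: sum_distrib_left)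
  also have "\<dots> = (\<Sum>(b, bs)\<in>Basis \<times> ?B (length as). blinfun_apply a b *
      ((\<Prod>i<length as. blinfun_apply (as ! i) (bs ! i)) *
        P (pre @ ?d b # map ?d bs @ cs)))"
    by (simp add: sum.cartesian_product)
  also have "\<dots> = (\<Sum>bs\<in>?B (length (a # as)).
      (\<Prod>i<length (a # as). blinfun_apply ((a # as) ! i) (bs ! i)) *
        P (pre @ map ?d bs @ cs))"
    by (rule sum.reindex_bij_witness[where i = "\<lambda>bs. (hd bs, tl bs)" and j = "\<lambda>(b, bs). b # bs"])
       (auto simp: length_Suc_conv prod.lessThan_Suc_shift mult_ac simp del: prod.lessThan_Suc)
  finally show ?case by simp
qed

lemma contract_wedge:
  assumes P: "alt_multilinear n P" and l: "length as + length cs = n"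
  shows "contract (length as) (wedge as) P cs = P (as @ cs)"
proof -
  let ?k = "length as"
  let ?B = "{bs :: 'a list. set bs \<subseteq> Basis \<and> length bs = ?k}"
  let ?S = "{\<sigma>. \<sigma> permutes {..<?k}}"
  let ?d = "blinfun_inner_left :: 'a \<Rightarrow> 'a \<Rightarrow>\<^sub>L real"
  define t where "t \<sigma> bs = map (\<lambda>i. bs ! \<sigma> i) [0..<?k]" for \<sigma> and bs :: "'a list"
  have tB: "t \<sigma> bs \<in> ?B" if "\<sigma> \<in> ?S" "bs \<in> ?B" for \<sigma> bs
  proof -
    have "\<sigma> i < ?k" if "i < ?k" for i using \<open>\<sigma> \<in> ?S\<close> that permutes_in_image by fastforce
    hence "set (t \<sigma> bs) \<subseteq> set bs" using that(2) by (auto simp: t_def)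
    thus ?thesis using that(2) by (auto simp: t_def)
  qed
  have tt: "t (inv_into UNIV \<sigma>) (t \<sigma> bs) = bs" "t \<sigma> (t (inv_into UNIV \<sigma>) bs) = bs" if "\<sigma> \<in> ?S" "bs \<in> ?B" for \<sigma> bs
  proof -
    have "\<sigma> i < ?k" "inv_into UNIV \<sigma> i < ?k" if "i < ?k" for i
      using \<open>\<sigma> \<in> ?S\<close> that permutes_in_image[of \<sigma>] permutes_in_image[OF permutes_inv, of \<sigma>]
      by fastforce+
    thus "t (inv_into UNIV \<sigma>) (t \<sigma> bs) = bs" "t \<sigma> (t (inv_into UNIV \<sigma>) bs) = bs"
      using that permutes_inverses[of \<sigma>] by (auto simp: t_def intro!: nth_equalityI)
  qed
  have summand: "(\<Sum>bs\<in>?B. of_int (sign \<sigma>) * (\<Prod>i<?k. blinfun_apply (as ! i) (bs ! \<sigma> i)) *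
      P (map ?d bs @ cs)) = P (as @ cs)" if s: "\<sigma> \<in> ?S" for \<sigma>
  proof -
    have "(\<Sum>bs\<in>?B. of_int (sign \<sigma>) * (\<Prod>i<?k. blinfun_apply (as ! i) (bs ! \<sigma> i)) *
        P (map ?d bs @ cs)) =
      (\<Sum>bs\<in>?B. (\<Prod>i<?k. blinfun_apply (as ! i) (bs ! i)) * P (map ?d bs @ cs))"
    proof (rule sum.reindex_bij_witness[where j = "t \<sigma>" and i = "t (inv_into UNIV \<sigma>)"])
      fix bs assume bs: "bs \<in> ?B"
      have lt: "\<sigma> i < ?k" if "i < ?k" for i using s that permutes_in_image by fastforce
      have "map ?d (t \<sigma> bs) = map (\<lambda>i. map ?d bs ! \<sigma> i) [0..<?k]"
        using bs lt by (auto simp: t_def)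
      hence "P (map ?d (t \<sigma> bs) @ cs) = of_int (sign \<sigma>) * P (map ?d bs @ cs)"
        using alt_multilinear_permute[OF P, of "map ?d bs" ?k cs \<sigma>] s bs l by simp
      moreover have "(\<Prod>i<?k. blinfun_apply (as ! i) (t \<sigma> bs ! i)) =
          (\<Prod>i<?k. blinfun_apply (as ! i) (bs ! \<sigma> i))"
        by (simp add: t_def)
      ultimately show "(\<Prod>i<?k. blinfun_apply (as ! i) (t \<sigma> bs ! i)) * P (map ?d (t \<sigma> bs) @ cs) =
          of_int (sign \<sigma>) * (\<Prod>i<?k. blinfun_apply (as ! i) (bs ! \<sigma> i)) * P (map ?d bs @ cs)"
        by simp
    next
      fix bs assume "bs \<in> ?B"
      thus "t (inv_into UNIV \<sigma>) bs \<in> ?B"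
        using tB[of "inv_into UNIV \<sigma>" bs] s permutes_inv[of \<sigma>] by simp
    next
      fix bs assume "bs \<in> ?B"
      thus "t \<sigma> bs \<in> ?B" using tB[of \<sigma> bs] s by simp
    qed (use s tt in simp_all)
    also have "\<dots> = P (as @ cs)"
      using alt_multilinear_expand[OF P, of "[]" as cs] l by simp
    finally show ?thesis .
  qed
  have "(\<Sum>bs\<in>?B. wedge as bs * P (map ?d bs @ cs)) =
      (\<Sum>bs\<in>?B. \<Sum>\<sigma>\<in>?S. of_int (sign \<sigma>) * (\<Prod>i<?k. blinfun_apply (as ! i) (bs ! \<sigma> i)) *
        P (map ?d bs @ cs))"
    by (rule sum.cong) (auto simp: wedge_def sum_distrib_right)
  also have "\<dots> = (\<Sum>\<sigma>\<in>?S. P (as @ cs))"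
    by (subst sum.swap) (simp add: summand)
  also have "\<dots> = fact ?k * P (as @ cs)"
    by (simp add: card_permutations[of "{..<?k}" ?k])
  finally show ?thesis unfolding contract_def by simp
qed

end

theory Submission
  imports Defs
begin

text \<open>
  Write \<open>X = #\<^sub>n\<^sub>-\<^sub>1(\<alpha>)\<close>. Since \<open>\<lbrakk>\<alpha>, h\<beta>\<rbrakk> = h\<lbrakk>\<alpha>, \<beta>\<rbrakk> + X(h)\<beta>\<close>, a central \<open>\<alpha>\<close> has \<open>X = 0\<close>.

  Conversely, if \<open>X = 0\<close>, the bracket with \<open>\<alpha>\<close> is multiplication by \<open>\<plusminus> i(d\<alpha>)\<Lambda>\<close>, which has to be shown
  to vanish at every point \<open>p\<close>. The second order part of the fundamental identity is a quadratic
  relation for \<open>\<Lambda>\<close> at \<open>p\<close>, which for \<open>n \<ge> 3\<close> implies the Pluecker relations. In a chart, write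
  \<open>\<alpha> = \<Sum>\<^sub>J a\<^sub>J dx\<^sub>J\<close>. Contracting \<open>\<alpha>\<close> with the first order part, the fundamental identity for the
  coordinate functions \<open>x\<^sub>J\<close>, and differentiating \<open>\<Sum>\<^sub>J a\<^sub>J i(dx\<^sub>J)\<Lambda> = 0\<close> yields
  \<open>\<Sum>\<^sub>J i(dx\<^sub>J)\<Lambda> \<and> i(da\<^sub>J)\<Lambda> = 0\<close>. By the Pluecker relations, this expression is
  \<open>\<plusminus> (i(d\<alpha>)\<Lambda>) \<Lambda>\<close>. Hence \<open>i(d\<alpha>)\<Lambda>\<close> vanishes wherever \<open>\<Lambda>\<close> does not, and trivially elsewhere.
\<close>

section \<open>Quadratic relations of alternating maps\<close>

lemma alt_multilinear_linear:
  "alt_multilinear k P \<Longrightarrow> length vs = k \<Longrightarrow> i < k \<Longrightarrow> linear (\<lambda>v. P (vs[i := v]))"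
  unfolding alt_multilinear_def by blast

lemma alt_multilinear_eq_0:
  "alt_multilinear k P \<Longrightarrow> length vs = k \<Longrightarrow> i < k \<Longrightarrow> j < k \<Longrightarrow> i \<noteq> j \<Longrightarrow> vs ! i = vs ! j \<Longrightarrow> P vs = 0"
  unfolding alt_multilinear_def by (metis linorder_neqE_nat)

text \<open>Downward induction on \<open>i\<close>: each step is a transposition of two neighbours,
  and \<open>k - i\<close> of them bring \<open>b\<close> to the end.\<close>

lemma alt_multilinear_insert:
  assumes P: "alt_multilinear (Suc k) P" and l: "length bs = k" and i: "i \<le> k"
  shows "P (take i bs @ b # drop i bs) = (-1) ^ (k - i) * P (bs @ [b])"
  using i
proof (induction i rule: inc_induct)
  case base
  then show ?case using l by simp
next
  case (step i)
  let ?us = "take (Suc i) bs @ b # drop (Suc i) bs"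
  have "take i bs @ b # drop i bs = ?us[i := ?us ! Suc i, Suc i := ?us ! i]"
  proof (rule nth_equalityI)
    fix j assume "j < length (take i bs @ b # drop i bs)"
    then show "(take i bs @ b # drop i bs) ! j = ?us[i := ?us ! Suc i, Suc i := ?us ! i] ! j"
      using l step.hyps
      by (cases "j \<le> Suc i")
        (auto simp: nth_append nth_list_update min_def le_Suc_eq nth_Cons split: nat.split
          intro!: arg_cong[of _ _ "nth bs"])
  qed (use l step.hyps in simp)
  hence "P (take i bs @ b # drop i bs) = - P ?us"
    using alt_multilinear_swap[OF P, of ?us i "Suc i"] l step.hyps by simp
  also have "P ?us = (-1) ^ (k - Suc i) * P (bs @ [b])" by (rule step.IH)
  finally show ?case using step.hyps by (simp add: Suc_diff_Suc[symmetric])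
qed

text \<open>The hypothesis \<open>quad\<close> is what the second order part of the fundamental
  identity says about \<Lambda> at a point. It is the Pluecker relation for lists with a repetition
  at the last place, where \<open>P as\<close> vanishes; in this form it is the part of the
  alternating property of \<open>defect\<close> that is not automatic.\<close>

locale quadratic_alt =
  fixes P :: "'v::real_vector list \<Rightarrow> real" and n :: nat
  assumes alt: "alt_multilinear n P" and n3: "n \<ge> 3"
    and quad: "\<And>as cs k. length as = n \<Longrightarrow> length cs = n \<Longrightarrow> k < n - 1 \<Longrightarrow> as ! k = as ! (n - 1) \<Longrightarrow>
      (\<Sum>i<n. P (as[n - 1 := cs ! i]) * P (cs[i := as ! (n - 1)])) = 0"
begin

text \<open>
  The Pluecker relations say that the defect vanishes. The quadratic relation makes it alternating
  in all \<open>2 * n\<close> entries together.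
\<close>

definition defect :: "'v list \<Rightarrow> 'v list \<Rightarrow> real" where
  "defect as cs =
     (\<Sum>i<n. P (as[n - 1 := cs ! i]) * P (cs[i := as ! (n - 1)])) - P as * P cs"

lemmas P_linear = alt_multilinear_linear[OF alt]
lemmas P_eq_0 = alt_multilinear_eq_0[OF alt]

lemma P_add: "length vs = n \<Longrightarrow> i < n \<Longrightarrow> P (vs[i := x + y]) = P (vs[i := x]) + P (vs[i := y])"
  by (rule linear_add[OF P_linear])

lemma P_scale: "length vs = n \<Longrightarrow> i < n \<Longrightarrow> P (vs[i := r *\<^sub>R x]) = r * P (vs[i := x])"
  using linear_scale[OF P_linear, of vs i r x] by simp

lemma linear_defect_left:
  assumes "length as = n" "length cs = n" "j < n"
  shows "linear (\<lambda>v. defect (as[j := v]) cs)"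
proof (cases "j = n - 1")
  case True
  show ?thesis
    by (rule linearI)
       (use assms True in \<open>simp_all add: defect_def P_add P_scale algebra_simps sum.distrib sum_distrib_left\<close>)
next
  case False
  have sw: "as[j := v, n - 1 := w] = as[n - 1 := w, j := v]" for v w
    using False by (simp add: list_update_swap)
  show ?thesis
    by (rule linearI)
       (use assms False in \<open>simp_all del: One_nat_def add: defect_def sw P_add P_scale algebra_simps sum.distrib sum_distrib_left\<close>)
qed

lemma linear_defect_right:
  assumes "length as = n" "length cs = n" "j < n"
  shows "linear (\<lambda>v. defect as (cs[j := v]))"
proof -
  \<comment> \<open>For \<open>i = j\<close> the second factor overwrites the entry
    \<open>v\<close>, which is left in the first factor only; for \<open>i \<noteq> j\<close> it is
    left in the second only. So each summand is linear in \<open>v\<close>.\<close>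
  have "P (as[n - 1 := cs[j := v] ! i]) * P (cs[j := v, i := x]) =
     (if i = j then P (as[n - 1 := v]) * P (cs[j := x]) else P (as[n - 1 := cs ! i]) * P (cs[i := x, j := v]))"
    for v x i using assms by (auto simp: list_update_swap)
  hence eq: "defect as (cs[j := v]) = (\<Sum>i<n. if i = j then P (as[n - 1 := v]) * P (cs[j := as ! (n - 1)])
     else P (as[n - 1 := cs ! i]) * P (cs[i := as ! (n - 1), j := v])) - P as * P (cs[j := v])" for v
    unfolding defect_def by (simp del: One_nat_def)
  have n: "n - 1 < n" using n3 by simp
  show ?thesis unfolding eq
    apply (rule linear_compose_sub)
     apply (rule linear_compose_sum)
     apply (intro ballI)
     subgoal for i
       using assms n P_linear[of as "n - 1"] P_linear[of "cs[i := as ! (n - 1)]" j]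
       by (cases "i = j") (auto intro!: linearI simp: P_add P_scale algebra_simps)
    subgoal using assms by (auto intro!: linearI simp: P_add P_scale algebra_simps)
    done
qed

text \<open>A repetition at the last place is covered by \<open>quad\<close>, and
  \<open>P as\<close> vanishes as well. Any other repetition persists in
  \<open>as[n - 1 := x]\<close>, so that every term vanishes.\<close>

lemma defect_eq_0_left:
  assumes l: "length as = n" "length cs = n" and ij: "i < j" "j < n" "as ! i = as ! j"
  shows "defect as cs = 0"
proof (cases "j = n - 1")
  case True
  have "P as = 0" using l ij P_eq_0[of as i j] by simp
  then show ?thesis using quad[of as cs i] l ij True by (simp add: defect_def)
next
  case False
  have "P as = 0" "\<And>x. P (as[n - 1 := x]) = 0"
    using l ij False P_eq_0[of as i j] P_eq_0[of "as[n - 1 := _]" i j] by simp_all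
  then show ?thesis by (simp add: defect_def)
qed

text \<open>Makes \<open>alt_multilinear_swap\<close> available for the left list; the extension by
  0 is the convention for lists of other lengths.\<close>

lemma alt_defect: "length cs = n \<Longrightarrow> alt_multilinear n (\<lambda>as. if length as = n then defect as cs else 0)"
  unfolding alt_multilinear_def
  by (simp add: linear_defect_left defect_eq_0_left)

text \<open>If the shared entry is the last one of \<open>as\<close>, the summands with
  \<open>i \<noteq> j\<close> have a repetition in \<open>cs\<close>, and the summand
  \<open>i = j\<close> is cancelled by \<open>P as * P cs\<close>. Antisymmetry in \<open>as\<close>
  reduces any other place to the last.\<close>

lemma defect_shared:
  assumes l: "length as = n" "length cs = n" and ij: "i < n" "j < n" "as ! i = cs ! j"
  shows "defect as cs = 0"
proof -
  have last: "defect as cs = 0" if l: "length as = n" and j: "j < n" "as ! (n - 1) = cs ! j" for as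
  proof -
    have "P (as[n - 1 := cs ! i]) * P (cs[i := as ! (n - 1)]) = (if i = j then P as * P cs else 0)"
      if "i < n" for i
    proof (cases "i = j")
      case True
      have "as[n - 1 := cs ! j] = as" "cs[j := as ! (n - 1)] = cs"
        by (metis j(2) list_update_id)+
      then show ?thesis using True by simp
    next
      case False
      hence "P (cs[i := as ! (n - 1)]) = 0"
        using that j l assms(2) by (intro P_eq_0[of _ i j]) auto
      then show ?thesis using False by simp
    qed
    hence "(\<Sum>i<n. P (as[n - 1 := cs ! i]) * P (cs[i := as ! (n - 1)])) = P as * P cs"
      using j by simp
    thus ?thesis by (simp add: defect_def)
  qed
  show ?thesis
  proof (cases "i = n - 1")
    case True
    then show ?thesis using last l ij by simp
  next
    case False
    let ?as = "as[i := as ! (n - 1), n - 1 := as ! i]"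
    have "defect ?as cs = - defect as cs"
      using alt_multilinear_swap[OF alt_defect[OF l(2)], of as i "n - 1"] l ij False n3 by simp
    moreover have "defect ?as cs = 0" using l ij False by (intro last) auto
    ultimately show ?thesis by simp
  qed
qed

text \<open>Polarization of \<open>defect_shared\<close>: \<open>H\<close> is additive in both
  arguments and vanishes on the diagonal, hence changes sign under exchange.\<close>

lemma defect_exchange:
  assumes l: "length as = n" "length cs = n" and ij: "i < n" "j < n"
  shows "defect (as[i := cs ! j]) (cs[j := as ! i]) = - defect as cs"
proof -
  define H where "H x y = defect (as[i := x]) (cs[j := y])" for x y
  have 1: "H (x + y) z = H x z + H y z" for x y z
    unfolding H_def using linear_add[OF linear_defect_left, of as "cs[j := z]" i x y] l ij by simp
  have 2: "H x (y + z) = H x y + H x z" for x y z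
    unfolding H_def using linear_add[OF linear_defect_right, of "as[i := x]" cs j y z] l ij by simp
  have 3: "H x x = 0" for x
    unfolding H_def using l ij by (intro defect_shared[of _ _ i j]) auto
  let ?x = "as ! i" and ?y = "cs ! j"
  have "H ?y ?x + H ?x ?y = 0" using 3[of "?x + ?y"] unfolding 1 2 by (simp add: 3)
  hence "H ?y ?x = - H ?x ?y" by linarith
  thus ?thesis by (simp add: H_def)
qed

text \<open>For \<open>P cs \<noteq> 0\<close>, the numbers \<open>P (cs[i := x]) / P cs\<close> are
  linear in \<open>x\<close> and are its coordinates if \<open>x\<close> lies in the span of
  \<open>cs\<close>. Their common kernel is a complement of this span.\<close>

definition orthogonal_to :: "'v list \<Rightarrow> 'v \<Rightarrow> bool" where
  "orthogonal_to cs x \<longleftrightarrow> (\<forall>i<n. P (cs[i := x]) = 0)"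

text \<open>The shared entry annihilates the defect. With the orthogonal entry in the last place its
  sum vanishes too, which leaves \<open>P ds * P cs = 0\<close>.\<close>

lemma mixed_eq_0:
  assumes l: "length ds = n" "length cs = n" and c: "P cs \<noteq> 0"
    and ds: "i < n" "k < n" "k \<noteq> i" "j < n" "ds ! i = cs ! j" "orthogonal_to cs (ds ! k)"
  shows "P ds = 0"
proof -
  have last: "P ds = 0"
    if "length ds = n" "i < n" "ds ! i = cs ! j" "orthogonal_to cs (ds ! (n - 1))" for ds i
  proof -
    have "defect ds cs = 0" using that l ds by (intro defect_shared[of _ _ i j]) auto
    moreover have "(\<Sum>i<n. P (ds[n - 1 := cs ! i]) * P (cs[i := ds ! (n - 1)])) = 0"
      using that by (intro sum.neutral) (auto simp: orthogonal_to_def)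
    ultimately show ?thesis using c by (simp add: defect_def)
  qed
  show ?thesis
  proof (cases "k = n - 1")
    case True
    then show ?thesis using last[of ds i] l ds by simp
  next
    case False
    let ?ds = "ds[k := ds ! (n - 1), n - 1 := ds ! k]"
    have "P ?ds = - P ds" using alt_multilinear_swap[OF alt, of ds k "n - 1"] l ds False by simp
    moreover have "P ?ds = 0"
    \<comment> \<open>If the shared entry was the last one, the swap has carried it to place
      \<open>k\<close>.\<close>
    proof (cases "i = n - 1")
      case True
      then show ?thesis using last[of ?ds k] l ds False by simp
    next
      case False
      then show ?thesis using last[of ?ds i] l ds by simp
    qed
    ultimately show ?thesis by simp
  qed
qed

text \<open>
  This is the step that fails for \<open>n = 2\<close>: after exchanging one entry of \<open>as\<close> with one of \<open>cs\<close>, the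
  first \<open>n - 1 \<ge> 2\<close> entries of the left list are already mixed.
\<close>

lemma defect_orthogonal:
  assumes l: "length as = n" "length cs = n" and c: "P cs \<noteq> 0"
    and as: "\<And>k. k < n \<Longrightarrow> orthogonal_to cs (as ! k)"
  shows "defect as cs = 0"
proof -
  let ?as = "as[0 := cs ! 0]" and ?cs = "cs[0 := as ! 0]"
  have "P (?as[n - 1 := x]) = 0" for x
    using l n3 as by (intro mixed_eq_0[OF _ l(2) c, of _ 0 1 0]) auto
  moreover have "P ?as = 0"
    using l n3 as by (intro mixed_eq_0[OF _ l(2) c, of _ 0 1 0]) auto
  ultimately have "defect ?as ?cs = 0" by (simp add: defect_def)
  thus ?thesis using defect_exchange[OF l, of 0 0] n3 by simp
qed

text \<open>\<open>\<pi>\<close> projects along the span of \<open>cs\<close> onto the orthogonal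
  vectors. Replacing an entry of \<open>as\<close> by its projection changes it by a combination of
  entries of \<open>cs\<close>, each of which contributes 0 by \<open>defect_shared\<close>. This
  reduces the claim to \<open>defect_orthogonal\<close>.\<close>

lemma defect_eq_0:
  assumes l: "length as = n" "length cs = n" and c: "P cs \<noteq> 0"
  shows "defect as cs = 0"
proof -
  define \<pi> where "\<pi> x = x - (\<Sum>i<n. (P (cs[i := x]) / P cs) *\<^sub>R cs ! i)" for x
  have \<pi>: "orthogonal_to cs (\<pi> x)" for x
    unfolding orthogonal_to_def
  proof (intro allI impI)
    fix i assume i: "i < n"
    have "P (cs[i := \<pi> x]) = P (cs[i := x]) - (\<Sum>j<n. (P (cs[j := x]) / P cs) * P (cs[i := cs ! j]))"
      unfolding \<pi>_def using l i
      by (simp add: linear_diff[OF P_linear] linear_sum[OF P_linear] P_scale)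
    also have "(\<Sum>j<n. (P (cs[j := x]) / P cs) * P (cs[i := cs ! j])) = (\<Sum>j<n. if j = i then P (cs[i := x]) else 0)"
    proof (rule sum.cong)
      fix j assume j: "j \<in> {..<n}"
      have "P (cs[i := cs ! j]) = 0" if "i \<noteq> j" using l i j that by (intro P_eq_0[of _ i j]) auto
      thus "(P (cs[j := x]) / P cs) * P (cs[i := cs ! j]) = (if j = i then P (cs[i := x]) else 0)"
        using c by auto
    qed simp
    finally show "P (cs[i := \<pi> x]) = 0" using i by simp
  qed
  have upd: "defect (bs[j := \<pi> x]) cs = defect (bs[j := x]) cs" if "length bs = n" "j < n" for bs j x
  proof -
    have "defect (bs[j := cs ! i]) cs = 0" if "i < n" for i
      using that l \<open>length bs = n\<close> \<open>j < n\<close> by (intro defect_shared[of _ _ j i]) auto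
    thus ?thesis unfolding \<pi>_def using that l
      by (simp add: linear_diff[OF linear_defect_left] linear_sum[OF linear_defect_left]
           linear_scale[OF linear_defect_left])
  qed
  have "defect (map \<pi> (take k as) @ drop k as) cs = defect as cs" if "k \<le> n" for k
    using that
  proof (induction k)
    case (Suc k)
    let ?bs = "map \<pi> (take k as) @ drop k as"
    have "map \<pi> (take (Suc k) as) @ drop (Suc k) as = ?bs[k := \<pi> (as ! k)]"
      using Suc.prems l by (simp add: take_Suc_conv_app_nth list_update_append flip: Cons_nth_drop_Suc)
    moreover have "?bs[k := as ! k] = ?bs"
      using Suc.prems l by (simp add: list_update_append flip: Cons_nth_drop_Suc)
    ultimately show ?case using upd[of ?bs k "as ! k"] Suc l by simp
  qed simp
  from this[of n] have "defect (map \<pi> as) cs = defect as cs" using l by simp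
  moreover have "defect (map \<pi> as) cs = 0" using l c \<pi> by (intro defect_orthogonal) auto
  ultimately show ?thesis by simp
qed

lemma pluecker:
  assumes "length as = n - 1" "length cs = n" "P cs \<noteq> 0"
  shows "(\<Sum>i<n. P (as @ [cs ! i]) * P (cs[i := x])) = P (as @ [x]) * P cs"
proof -
  have "(as @ [x])[n - 1 := y] = as @ [y]" "(as @ [x]) ! (n - 1) = x" for y
    using assms by (simp_all del: One_nat_def flip: assms(1))
  thus ?thesis using defect_eq_0[of "as @ [x]" cs] assms n3 by (simp add: defect_def)
qed

end

section \<open>Smooth functions\<close>

lemma Ck_on_cong:
  assumes "open S" "\<And>x. x \<in> S \<Longrightarrow> f x = g x" "Ck_on k S f"
  shows "Ck_on k S g"
  using assms(2,3)
proof (induction k arbitrary: f g)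
  case 0
  then show ?case by (simp cong: continuous_on_cong)
next
  case (Suc k)
  have diff: "g differentiable (at x)" if "x \<in> S" for x
    using Ck_on.simps(2) Suc.prems that assms(1)
    unfolding differentiable_def by (meson has_derivative_transform_within_open)
  have "frechet_derivative g (at x) = frechet_derivative f (at x)" if "x \<in> S" for x
    using Suc.prems that assms(1)
    by (intro frechet_derivative_transform_within_open[symmetric]) auto
  with Suc.IH[of "\<lambda>x. frechet_derivative f (at x) v" "\<lambda>x. frechet_derivative g (at x) v" for v]
  show ?case using Suc.prems(2) diff by simp
qed

lemma Ck_on_SucI:
  assumes "open S" "\<And>x. x \<in> S \<Longrightarrow> (f has_derivative f' x) (at x)" "\<And>v. Ck_on k S (\<lambda>x. f' x v)"
  shows "Ck_on (Suc k) S f"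
proof -
  have "frechet_derivative f (at x) = f' x" if "x \<in> S" for x
    using frechet_derivative_at[OF assms(2)[OF that]] by simp
  hence "Ck_on k S (\<lambda>x. frechet_derivative f (at x) v)" for v
    by (intro Ck_on_cong[OF assms(1) _ assms(3)[of v]]) simp
  thus ?thesis using assms(2) by (auto simp: differentiable_def)
qed

lemma Ck_on_SucD:
  "Ck_on (Suc k) S f \<Longrightarrow> x \<in> S \<Longrightarrow> (f has_derivative frechet_derivative f (at x)) (at x)"
  "Ck_on (Suc k) S f \<Longrightarrow> Ck_on k S (\<lambda>x. frechet_derivative f (at x) v)"
  by (simp_all add: frechet_derivative_works[symmetric])

lemma Ck_on_Suc_imp: "Ck_on (Suc k) S f \<Longrightarrow> Ck_on k S f"
proof (induction k arbitrary: f)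
  case 0
  then show ?case
    by (auto intro!: continuous_at_imp_continuous_on differentiable_imp_continuous_within)
next
  case (Suc k)
  then show ?case by (simp del: Ck_on.simps add: Ck_on.simps(2)[of k S f]) (simp add: Suc.IH)
qed

lemma Ck_on_local:
  assumes "\<And>x. x \<in> S \<Longrightarrow> \<exists>U. open U \<and> x \<in> U \<and> Ck_on k U f"
  shows "Ck_on k S f"
  using assms
proof (induction k arbitrary: f)
  case 0
  have "isCont f x" if "x \<in> S" for x
    using 0[OF that] by (auto simp: continuous_on_eq_continuous_at)
  then show ?case by (simp add: continuous_at_imp_continuous_on)
next
  case (Suc k)
  have "\<forall>x\<in>S. f differentiable at x" using Suc.prems by fastforce
  moreover have "Ck_on k S (\<lambda>x. frechet_derivative f (at x) v)" for v
    by (rule Suc.IH) (use Suc.prems in fastforce)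
  ultimately show ?case by simp
qed

lemma Ck_on_const: "open S \<Longrightarrow> Ck_on k S (\<lambda>x. c)"
proof (induction k arbitrary: c)
  case (Suc k)
  show ?case by (rule Ck_on_SucI[where f' = "\<lambda>x v. 0"]) (use Suc in auto)
qed simp

lemma Ck_on_bounded_linear:
  assumes h: "bounded_linear h" and "open S" "Ck_on k S f"
  shows "Ck_on k S (\<lambda>x. h (f x))"
  using assms(3)
proof (induction k arbitrary: f)
  case 0
  then show ?case using bounded_linear.continuous_on[OF h] by simp
next
  case (Suc k)
  show ?case
    by (rule Ck_on_SucI[where f' = "\<lambda>x v. h (frechet_derivative f (at x) v)"])
       (use assms(2) Suc Ck_on_SucD[OF Suc.prems] in
         \<open>auto intro!: bounded_linear.has_derivative[OF h] simp del: Ck_on.simps\<close>)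
qed

lemma Ck_on_add:
  assumes "open S" "Ck_on k S f" "Ck_on k S g"
  shows "Ck_on k S (\<lambda>x. f x + g x)"
  using assms(2,3)
proof (induction k arbitrary: f g)
  case 0
  then show ?case by (simp add: continuous_on_add)
next
  case (Suc k)
  show ?case
    by (rule Ck_on_SucI[where f' = "\<lambda>x v. frechet_derivative f (at x) v + frechet_derivative g (at x) v"])
       (use assms(1) Suc.IH Ck_on_SucD[OF Suc.prems(1)] Ck_on_SucD[OF Suc.prems(2)] in
         \<open>auto intro!: has_derivative_add simp del: Ck_on.simps\<close>)
qed

lemma Ck_on_scaleR:
  fixes f :: "'e::real_normed_vector \<Rightarrow> real"
  assumes "open S" "Ck_on k S f" "Ck_on k S g"
  shows "Ck_on k S (\<lambda>x. f x *\<^sub>R g x)"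
  using assms(2,3)
proof (induction k arbitrary: f g)
  case 0
  then show ?case by (simp add: continuous_on_scaleR)
next
  case (Suc k)
  show ?case
    by (rule Ck_on_SucI[where f' = "\<lambda>x v. f x *\<^sub>R frechet_derivative g (at x) v
          + frechet_derivative f (at x) v *\<^sub>R g x"])
       (use assms(1) Suc.IH Ck_on_SucD[OF Suc.prems(1)] Ck_on_SucD[OF Suc.prems(2)]
          Ck_on_Suc_imp[OF Suc.prems(1)] Ck_on_Suc_imp[OF Suc.prems(2)] in
         \<open>auto intro!: has_derivative_scaleR Ck_on_add simp del: Ck_on.simps\<close>)
qed

lemma Ck_on_sum:
  assumes "open S" "\<And>i. i \<in> I \<Longrightarrow> Ck_on k S (f i)"
  shows "Ck_on k S (\<lambda>x. \<Sum>i\<in>I. f i x)"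
  using assms(2)
  by (induction I rule: infinite_finite_induct) (auto intro: Ck_on_const Ck_on_add assms(1))

lemma has_derivative_basis_expansion:
  assumes "(f has_derivative f') (at x)"
  shows "f' v = (\<Sum>b\<in>Basis. (v \<bullet> b) *\<^sub>R f' b)"
proof -
  have l: "linear f'" using assms by (rule has_derivative_linear)
  have "f' v = f' (\<Sum>b\<in>Basis. (v \<bullet> b) *\<^sub>R b)" by (simp add: euclidean_representation)
  also have "\<dots> = (\<Sum>b\<in>Basis. (v \<bullet> b) *\<^sub>R f' b)" by (simp add: linear_sum[OF l] linear_scale[OF l])
  finally show ?thesis .
qed

text \<open>In the chain rule the direction in which \<open>f\<close> is differentiated depends on
  \<open>x\<close>, while \<open>Ck_on\<close> speaks of fixed directions. Expanding the direction
  in the basis gives scalar factors times derivatives of \<open>f\<close> in fixed directions, to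
  which the induction hypothesis applies.\<close>

lemma Ck_on_compose:
  fixes f :: "'f::euclidean_space \<Rightarrow> 'g::real_normed_vector"
  assumes S: "open S" and T: "open T" and gT: "\<And>x. x \<in> S \<Longrightarrow> g x \<in> T"
    and "Ck_on k T f" "Ck_on k S g"
  shows "Ck_on k S (\<lambda>x. f (g x))"
  using assms(4,5)
proof (induction k arbitrary: f)
  case 0
  then show ?case using gT continuous_on_compose2[of T f S g] by auto
next
  case (Suc k)
  let ?f = "\<lambda>y. frechet_derivative f (at y)" and ?g = "\<lambda>x. frechet_derivative g (at x)"
  show ?case
  proof (rule Ck_on_SucI[OF S, where f' = "\<lambda>x v. \<Sum>b\<in>Basis. (?g x v \<bullet> b) *\<^sub>R ?f (g x) b"])
    fix x assume x: "x \<in> S"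
    have f: "(f has_derivative ?f (g x)) (at (g x))" using Ck_on_SucD(1)[OF Suc.prems(1) gT[OF x]] .
    show "((\<lambda>x. f (g x)) has_derivative (\<lambda>v. \<Sum>b\<in>Basis. (?g x v \<bullet> b) *\<^sub>R ?f (g x) b)) (at x)"
      unfolding has_derivative_basis_expansion[OF f, symmetric]
      by (rule has_derivative_compose[OF Ck_on_SucD(1)[OF Suc.prems(2) x] f])
  next
    fix v
    show "Ck_on k S (\<lambda>x. \<Sum>b\<in>Basis. (?g x v \<bullet> b) *\<^sub>R ?f (g x) b)"
      using Suc.IH[OF Ck_on_SucD(2)[OF Suc.prems(1)] Ck_on_Suc_imp[OF Suc.prems(2)]]
        Ck_on_SucD(2)[OF Suc.prems(2)] S
      by (intro Ck_on_sum Ck_on_scaleR Ck_on_bounded_linear[OF bounded_linear_inner_left])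
  qed
qed

section \<open>Smooth maps\<close>

lemma smooth_on_cong: "open S \<Longrightarrow> (\<And>x. x \<in> S \<Longrightarrow> f x = g x) \<Longrightarrow> smooth_on S f \<Longrightarrow> smooth_on S g"
  unfolding smooth_on_def by (intro allI Ck_on_cong[of S f g]) simp_all

lemma smooth_on_local:
  assumes "\<And>x. x \<in> S \<Longrightarrow> \<exists>U. open U \<and> x \<in> U \<and> smooth_on U f"
  shows "smooth_on S f"
  unfolding smooth_on_def
proof
  fix k
  have "\<exists>U. open U \<and> x \<in> U \<and> Ck_on k U f" if "x \<in> S" for x
    using assms[OF that] by (auto simp: smooth_on_def)
  thus "Ck_on k S f" by (rule Ck_on_local)
qed

lemma smooth_on_const: "open S \<Longrightarrow> smooth_on S (\<lambda>x. c)"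
  unfolding smooth_on_def by (intro allI Ck_on_const) simp_all

lemma smooth_on_bounded_linear:
  "bounded_linear h \<Longrightarrow> open S \<Longrightarrow> smooth_on S f \<Longrightarrow> smooth_on S (\<lambda>x. h (f x))"
  unfolding smooth_on_def by (intro allI, rule Ck_on_bounded_linear) simp_all

lemma smooth_on_add:
  "open S \<Longrightarrow> smooth_on S f \<Longrightarrow> smooth_on S g \<Longrightarrow> smooth_on S (\<lambda>x. f x + g x)"
  unfolding smooth_on_def by (intro allI Ck_on_add) simp_all

lemma smooth_on_scaleR:
  fixes f :: "'e::real_normed_vector \<Rightarrow> real"
  shows "open S \<Longrightarrow> smooth_on S f \<Longrightarrow> smooth_on S g \<Longrightarrow> smooth_on S (\<lambda>x. f x *\<^sub>R g x)"
  unfolding smooth_on_def by (intro allI Ck_on_scaleR) simp_all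

lemma smooth_on_mult:
  fixes f g :: "'e::real_normed_vector \<Rightarrow> real"
  shows "open S \<Longrightarrow> smooth_on S f \<Longrightarrow> smooth_on S g \<Longrightarrow> smooth_on S (\<lambda>x. f x * g x)"
  using smooth_on_scaleR[of S f g] by simp

lemma smooth_on_sum:
  "open S \<Longrightarrow> (\<And>i. i \<in> I \<Longrightarrow> smooth_on S (f i)) \<Longrightarrow> smooth_on S (\<lambda>x. \<Sum>i\<in>I. f i x)"
  unfolding smooth_on_def by (intro allI Ck_on_sum) simp_all

lemma smooth_on_compose:
  fixes f :: "'f::euclidean_space \<Rightarrow> 'g::real_normed_vector"
  shows "open S \<Longrightarrow> open T \<Longrightarrow> (\<And>x. x \<in> S \<Longrightarrow> g x \<in> T) \<Longrightarrow> smooth_on T f \<Longrightarrow> smooth_on S g \<Longrightarrow>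
    smooth_on S (\<lambda>x. f (g x))"
  unfolding smooth_on_def by (intro allI, rule Ck_on_compose[where T = T]) simp_all

lemma smooth_on_differentiable:
  assumes "smooth_on S f" "x \<in> S"
  shows "f differentiable (at x)"
proof -
  have "Ck_on (Suc 0) S f" using assms(1) unfolding smooth_on_def ..
  thus ?thesis using assms(2) by simp
qed

lemma smooth_on_has_derivative:
  "smooth_on S f \<Longrightarrow> x \<in> S \<Longrightarrow> (f has_derivative frechet_derivative f (at x)) (at x)"
  by (simp add: smooth_on_differentiable flip: frechet_derivative_works)

lemma smooth_on_frechet_derivative:
  "smooth_on S f \<Longrightarrow> smooth_on S (\<lambda>x. frechet_derivative f (at x) v)"
  unfolding smooth_on_def by (intro allI Ck_on_SucD(2)) (rule spec)

text \<open>Serves for explicit families such as \<open>flat_exp\<close>, whose derivatives stay in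
  the family. In the base case \<open>step\<close> is used twice, since class C^1 asks for
  continuity of the derivative.\<close>

lemma smooth_on_coinduct:
  assumes S: "open S" and "X f"
    and step: "\<And>f. X f \<Longrightarrow> \<exists>f'. (\<forall>x\<in>S. (f has_derivative f' x) (at x)) \<and> (\<forall>v. X (\<lambda>x. f' x v))"
  shows "smooth_on S f"
proof -
  have "Ck_on (Suc k) S f" for k
    using assms(2)
  proof (induction k arbitrary: f)
    case 0
    obtain f' where f': "\<And>x. x \<in> S \<Longrightarrow> (f has_derivative f' x) (at x)" "\<And>v. X (\<lambda>x. f' x v)"
      using step[OF 0] by blast
    have "continuous_on S (\<lambda>x. f' x v)" for v
    proof -
      obtain f'' where "\<And>x. x \<in> S \<Longrightarrow> ((\<lambda>x. f' x v) has_derivative f'' x) (at x)"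
        using step[OF f'(2)[of v]] by blast
      thus ?thesis by (intro continuous_at_imp_continuous_on ballI) (rule has_derivative_continuous)
    qed
    thus ?case by (intro Ck_on_SucI[OF S f'(1)]) simp_all
  next
    case (Suc k)
    obtain f' where f': "\<And>x. x \<in> S \<Longrightarrow> (f has_derivative f' x) (at x)" "\<And>v. X (\<lambda>x. f' x v)"
      using step[OF Suc.prems] by blast
    show ?case by (rule Ck_on_SucI[OF S f'(1) Suc.IH[OF f'(2)]])
  qed
  hence "Ck_on k S f" for k by (rule Ck_on_Suc_imp)
  thus ?thesis by (simp add: smooth_on_def)
qed

lemma smooth_on_id: "open S \<Longrightarrow> smooth_on S (\<lambda>x. x)"
proof (rule smooth_on_coinduct[where X = "\<lambda>f. f = (\<lambda>x. x) \<or> (\<exists>c. f = (\<lambda>x. c))"])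
  fix f :: "'a \<Rightarrow> 'a" assume "f = (\<lambda>x. x) \<or> (\<exists>c. f = (\<lambda>x. c))"
  thus "\<exists>f'. (\<forall>x\<in>S. (f has_derivative f' x) (at x)) \<and>
      (\<forall>v. (\<lambda>x. f' x v) = (\<lambda>x. x) \<or> (\<exists>c. (\<lambda>x. f' x v) = (\<lambda>x. c)))"
    by (elim disjE) (rule exI[of _ "\<lambda>x v. v"], force, rule exI[of _ "\<lambda>x v. 0"], force)
qed auto

lemma smooth_on_inner_left: "open S \<Longrightarrow> smooth_on S f \<Longrightarrow> smooth_on S (\<lambda>x. f x \<bullet> b)"
  by (rule smooth_on_bounded_linear[OF bounded_linear_inner_left])

text \<open>\<open>pre\<close> holds the arguments that are already frozen. The induction expands
  the first varying argument in the basis and appends the basis vectors to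
  \<open>pre\<close>.\<close>

lemma smooth_on_multilinear:
  fixes \<omega> :: "'f::euclidean_space list \<Rightarrow> real"
  assumes S: "open S" and l: "length pre + length ys = k"
    and \<omega>: "\<And>vs i. length vs = k \<Longrightarrow> i < k \<Longrightarrow> linear (\<lambda>v. \<omega> (vs[i := v]))"
    and ys: "\<And>y. y \<in> set ys \<Longrightarrow> smooth_on S y"
  shows "smooth_on S (\<lambda>x. \<omega> (pre @ map (\<lambda>y. y x) ys))"
  using l ys
proof (induction ys arbitrary: pre)
  case Nil
  then show ?case using smooth_on_const[OF S] by simp
next
  case (Cons y ys)
  have "\<omega> (pre @ map (\<lambda>y. y x) (y # ys)) = (\<Sum>b\<in>Basis. (y x \<bullet> b) * \<omega> ((pre @ [b]) @ map (\<lambda>y. y x) ys))" for x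
  proof -
    let ?L = "\<lambda>v. \<omega> (pre @ v # map (\<lambda>y. y x) ys)"
    have l: "linear ?L" using \<omega>[of "pre @ 0 # map (\<lambda>y. y x) ys" "length pre"] Cons.prems by simp
    have "?L (y x) = ?L (\<Sum>b\<in>Basis. (y x \<bullet> b) *\<^sub>R b)" by (simp add: euclidean_representation)
    also have "\<dots> = (\<Sum>b\<in>Basis. (y x \<bullet> b) * ?L b)" by (simp add: linear_sum[OF l] linear_scale[OF l])
    finally show ?thesis by simp
  qed
  moreover have "smooth_on S (\<lambda>x. \<Sum>b\<in>Basis. (y x \<bullet> b) * \<omega> ((pre @ [b]) @ map (\<lambda>y. y x) ys))"
    using Cons by (intro smooth_on_sum smooth_on_mult smooth_on_inner_left S Cons.IH) auto
  ultimately show ?case by (simp del: append_assoc)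
qed

section \<open>Bump functions\<close>

text \<open>The smooth, non-analytic function \<open>exp (- inverse t)\<close>, extended by 0; the
  factor polynomial in \<open>inverse t\<close> makes the family closed under
  differentiation.\<close>

definition flat_exp :: "real poly \<Rightarrow> real \<Rightarrow> real" where
  "flat_exp p t = (if t > 0 then poly p (inverse t) * exp (- inverse t) else 0)"

lemma poly_times_exp_neg_tendsto_0: "((\<lambda>y. poly p y * exp (- y)) \<longlongrightarrow> (0::real)) at_top"
proof -
  have "((\<lambda>y. \<Sum>i\<le>degree p. coeff p i * (y ^ i / exp y)) \<longlongrightarrow> (\<Sum>i\<le>degree p. coeff p i * 0)) at_top"
    by (intro tendsto_sum tendsto_mult tendsto_const tendsto_power_div_exp_0)
  moreover have "(\<Sum>i\<le>degree p. coeff p i * (y ^ i / exp y)) = poly p y * exp (- y)" for y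
    by (simp add: poly_altdef exp_minus divide_inverse sum_distrib_right mult.assoc)
  ultimately show ?thesis by simp
qed

lemma flat_exp_tendsto_0: "(flat_exp p \<longlongrightarrow> 0) (at 0)"
proof -
  have "((\<lambda>t. poly p (inverse t) * exp (- inverse t)) \<longlongrightarrow> 0) (at_right (0::real))"
    by (rule filterlim_compose[OF poly_times_exp_neg_tendsto_0 filterlim_inverse_at_top_right])
  hence "(flat_exp p \<longlongrightarrow> 0) (at_right 0)"
    by (rule Lim_transform_eventually) (auto simp: eventually_at_filter flat_exp_def)
  moreover have "(flat_exp p \<longlongrightarrow> 0) (at_left 0)"
    by (rule Lim_transform_eventually[OF tendsto_const]) (auto simp: eventually_at_filter flat_exp_def)
  ultimately show ?thesis by (simp add: filterlim_at_split)
qed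

text \<open>With \<open>s = inverse t\<close>, the derivative of \<open>poly p s * exp (- s)\<close>
  with respect to \<open>t\<close> is
  \<open>s^2 * (poly p s - poly (pderiv p) s) * exp (- s)\<close>.\<close>

lemma flat_exp_has_derivative:
  "(flat_exp p has_real_derivative flat_exp ([:0, 0, 1:] * (p - pderiv p)) t) (at t)"
proof (cases t "0::real" rule: linorder_cases)
  case less
  have "((\<lambda>t. 0) has_real_derivative 0) (at t)" by simp
  hence "(flat_exp p has_real_derivative 0) (at t)"
    by (rule DERIV_cong_ev[THEN iffD1, rotated -1])
       (use less in \<open>auto simp: flat_exp_def eventually_nhds intro!: exI[of _ "{..<0}"]\<close>)
  then show ?thesis using less by (simp add: flat_exp_def)
next
  case equal
  \<comment> \<open>At 0 the difference quotient belongs to the family itself: the division by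
    \<open>h\<close> is one more factor \<open>inverse h\<close>.\<close>
  have "((\<lambda>h. flat_exp ([:0, 1:] * p) h) \<longlongrightarrow> 0) (at 0)" by (rule flat_exp_tendsto_0)
  moreover have "flat_exp ([:0, 1:] * p) = (\<lambda>h. (flat_exp p (0 + h) - flat_exp p 0) / h)"
    by (auto simp: flat_exp_def fun_eq_iff field_simps)
  moreover have "flat_exp ([:0, 0, 1:] * (p - pderiv p)) 0 = 0" by (simp add: flat_exp_def)
  ultimately show ?thesis by (simp only: equal DERIV_def)
next
  case greater
  have "((\<lambda>t. poly p (inverse t) * exp (- inverse t)) has_real_derivative
      flat_exp ([:0, 0, 1:] * (p - pderiv p)) t) (at t)"
    using greater
    by (auto intro!: derivative_eq_intros DERIV_chain2[OF poly_DERIV]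
          simp: flat_exp_def algebra_simps power2_eq_square)
  thus ?thesis
    by (rule DERIV_cong_ev[THEN iffD1, rotated -1])
       (use greater in \<open>auto simp: flat_exp_def eventually_nhds intro!: exI[of _ "{0<..}"]\<close>)
qed

lemma smooth_on_flat_exp: "smooth_on UNIV (flat_exp p)"
proof (rule smooth_on_coinduct[where X = "\<lambda>f. \<exists>p. f = flat_exp p"])
  fix f assume "\<exists>p. f = flat_exp p"
  then obtain p where p: "f = flat_exp p" by blast
  define q where "q = [:0, 0, 1:] * (p - pderiv p)"
  have "\<exists>p'. (\<lambda>x. flat_exp q x * v) = flat_exp p'" for v
    by (rule exI[of _ "[:v:] * q"]) (simp add: flat_exp_def fun_eq_iff)
  moreover have "(f has_derivative (\<lambda>v. flat_exp q x * v)) (at x)" for x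
    using flat_exp_has_derivative[of p x] unfolding p q_def has_field_derivative_def by (simp only:)
  ultimately show "\<exists>f'. (\<forall>x\<in>UNIV. (f has_derivative f' x) (at x)) \<and> (\<forall>v. \<exists>p. (\<lambda>x. f' x v) = flat_exp p)"
    by (intro exI[of _ "\<lambda>x v. flat_exp q x * v"]) simp
qed auto

text \<open>Provides division by positive smooth functions: the case \<open>c = 1\<close>,
  \<open>k = 1\<close> is composed with the denominator of the bump function.\<close>

lemma smooth_on_inverse_power: "smooth_on {0<..} (\<lambda>t::real. c * inverse t ^ k)"
proof (rule smooth_on_coinduct[where X = "\<lambda>f. \<exists>c k. f = (\<lambda>t::real. c * inverse t ^ k)"])
  fix f assume "\<exists>c k. f = (\<lambda>t::real. c * inverse t ^ k)"
  then obtain c k where f: "f = (\<lambda>t::real. c * inverse t ^ k)" by blast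
  have "(f has_derivative (\<lambda>v. - v * c * k * inverse t ^ Suc k)) (at t)" if "t \<in> {0<..}" for t
  proof -
    have "(f has_real_derivative c * (real k * (- (inverse t ^ Suc (Suc 0)) * inverse t ^ (k - Suc 0)))) (at t)"
      unfolding f using that by (intro DERIV_cmult DERIV_power DERIV_inverse) auto
    also have "c * (real k * (- (inverse t ^ Suc (Suc 0)) * inverse t ^ (k - Suc 0))) = - c * k * inverse t ^ Suc k"
      by (cases k) simp_all
    finally have "(f has_real_derivative - c * k * inverse t ^ Suc k) (at t)" .
    moreover have "(\<lambda>v. - c * k * inverse t ^ Suc k * v) = (\<lambda>v. - v * c * k * inverse t ^ Suc k)"
      by (simp add: fun_eq_iff)
    ultimately show ?thesis by (simp only: has_field_derivative_def)
  qed
  moreover have "\<exists>c' k'. (\<lambda>t::real. - v * c * k * inverse t ^ Suc k) = (\<lambda>t. c' * inverse t ^ k')" for v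
    by (rule exI[of _ "- v * c * k"], rule exI[of _ "Suc k"]) simp
  ultimately show "\<exists>f'. (\<forall>x\<in>{0<..}. (f has_derivative f' x) (at x)) \<and>
      (\<forall>v. \<exists>c k. (\<lambda>x. f' x v) = (\<lambda>t. c * inverse t ^ k))"
    by (intro exI[of _ "\<lambda>t v. - v * c * k * inverse t ^ Suc k"]) simp
qed auto

text \<open>The bump function is \<open>a / (a + b)\<close>, where \<open>a\<close> is positive
  exactly on the open ball of radius \<open>r\<close> and \<open>b\<close> exactly outside the
  closed ball of radius \<open>r / 2\<close>.\<close>

lemma exists_bump:
  fixes x0 :: "'e::euclidean_space"
  assumes r: "r > 0"
  shows "\<exists>\<psi> U. smooth_on UNIV \<psi> \<and> (\<forall>x. x \<notin> cball x0 r \<longrightarrow> \<psi> x = (0::real)) \<and>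
    open U \<and> x0 \<in> U \<and> (\<forall>x\<in>U. \<psi> x = 1)"
proof -
  define a where "a x = flat_exp 1 (r\<^sup>2 - (x - x0) \<bullet> (x - x0))" for x
  define b where "b x = flat_exp 1 ((x - x0) \<bullet> (x - x0) - r\<^sup>2 / 4)" for x
  have pos: "flat_exp 1 t \<ge> 0" "flat_exp 1 t > 0 \<longleftrightarrow> t > 0" for t by (auto simp: flat_exp_def)
  have sq: "smooth_on UNIV (\<lambda>x. (x - x0) \<bullet> (x - x0))"
  proof -
    have "smooth_on UNIV (\<lambda>x. (x - x0) \<bullet> i)" for i
      using smooth_on_add[OF _ smooth_on_id smooth_on_const[of _ "- x0"], of UNIV]
      by (intro smooth_on_inner_left) auto
    hence "smooth_on UNIV (\<lambda>x. \<Sum>i\<in>Basis. ((x - x0) \<bullet> i) * ((x - x0) \<bullet> i))"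
      by (intro smooth_on_sum smooth_on_mult) auto
    thus ?thesis by (subst euclidean_inner)
  qed
  have sa: "smooth_on UNIV a" unfolding a_def
    using smooth_on_add[OF _ smooth_on_const[of _ "r\<^sup>2"] smooth_on_bounded_linear[OF bounded_linear_minus[OF bounded_linear_ident] _ sq]]
    by (intro smooth_on_compose[OF _ _ _ smooth_on_flat_exp]) auto
  have sb: "smooth_on UNIV b" unfolding b_def
    using smooth_on_add[OF _ sq smooth_on_const[of _ "- (r\<^sup>2 / 4)"]]
    by (intro smooth_on_compose[OF _ _ _ smooth_on_flat_exp]) auto
  have ab: "a x + b x > 0" for x
  proof -
    have "r\<^sup>2 > 0" using r by simp
    \<comment> \<open>The two arguments of \<open>flat_exp\<close> add up to
      \<open>3 / 4 * r\<^sup>2\<close>, so one of them is positive.\<close>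
    hence "r\<^sup>2 - (x - x0) \<bullet> (x - x0) > 0 \<or> (x - x0) \<bullet> (x - x0) - r\<^sup>2 / 4 > 0" by linarith
    hence "a x > 0 \<or> b x > 0" by (simp only: a_def b_def pos)
    moreover have "a x \<ge> 0" "b x \<ge> 0" by (simp_all only: a_def b_def pos)
    ultimately show ?thesis by linarith
  qed
  have "smooth_on UNIV (\<lambda>x. 1 * inverse (a x + b x) ^ 1)"
    by (rule smooth_on_compose[OF _ _ _ smooth_on_inverse_power]) (use ab sa sb in \<open>auto intro: smooth_on_add\<close>)
  hence s: "smooth_on UNIV (\<lambda>x. a x * inverse (a x + b x))"
    using sa by (intro smooth_on_mult) auto
  have nrm: "(x - x0) \<bullet> (x - x0) = (dist x0 x)\<^sup>2" for x
    by (metis dist_norm dist_commute power2_norm_eq_inner)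
  have "a x * inverse (a x + b x) = 0" if "x \<notin> cball x0 r" for x
  proof -
    have "(dist x0 x)\<^sup>2 > r\<^sup>2" using r that by (intro power_strict_mono) auto
    thus ?thesis by (simp add: a_def flat_exp_def nrm)
  qed
  moreover have "a x * inverse (a x + b x) = 1" if "x \<in> ball x0 (r / 2)" for x
  proof -
    have "(dist x0 x)\<^sup>2 < (r / 2)\<^sup>2" using that by (intro power_strict_mono) auto
    hence "b x = 0" by (simp add: b_def flat_exp_def nrm power2_eq_square)
    thus ?thesis using ab[of x] by simp
  qed
  ultimately show ?thesis using s r
    by (intro exI[of _ "\<lambda>x. a x * inverse (a x + b x)"] exI[of _ "ball x0 (r / 2)"]) simp
qed

section \<open>Charts and transition maps\<close>

lemma alt_multilinear_map:
  fixes T :: "'u::real_vector \<Rightarrow> 'v::real_vector"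
  assumes \<omega>: "alt_multilinear k \<omega>" and T: "linear T"
  shows "alt_multilinear k (\<lambda>vs. r * \<omega> (map T vs))"
  unfolding alt_multilinear_def
proof (intro conjI allI impI)
  fix vs :: "'u list" assume "length vs \<noteq> k"
  thus "r * \<omega> (map T vs) = 0" using \<omega> unfolding alt_multilinear_def by simp
next
  fix vs :: "'u list" and i assume *: "length vs = k" "i < k"
  have l: "linear (\<lambda>v. \<omega> ((map T vs)[i := v]))" using * by (intro alt_multilinear_linear[OF \<omega>]) auto
  have "linear (\<lambda>v. r * \<omega> ((map T vs)[i := T v]))"
    by (rule linearI) (simp_all add: linear_add[OF T] linear_scale[OF T] linear_add[OF l] linear_scale[OF l] algebra_simps)
  thus "linear (\<lambda>v. r * \<omega> (map T (vs[i := v])))" by (simp add: map_update)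
next
  fix vs :: "'u list" and i j assume *: "length vs = k" "i < j" "j < k" "vs ! i = vs ! j"
  hence "\<omega> (map T vs) = 0" by (intro alt_multilinear_eq_0[OF \<omega>, of _ i j]) auto
  thus "r * \<omega> (map T vs) = 0" by simp
qed

lemma
  assumes "is_chart M c"
  shows chart_dom_subset: "chart_dom c \<subseteq> topspace M"
    and openin_chart_dom: "openin M (chart_dom c)"
    and open_chart_image: "open (chart_image c)"
    and chart_inv_coords: "p \<in> chart_dom c \<Longrightarrow> chart_inv c (snd c p) = p"
    and coords_chart_inv: "x \<in> chart_image c \<Longrightarrow> snd c (chart_inv c x) = x"
    and chart_inv_in_dom: "x \<in> chart_image c \<Longrightarrow> chart_inv c x \<in> chart_dom c"
    and open_coords_image: "openin M V \<Longrightarrow> V \<subseteq> chart_dom c \<Longrightarrow> open (snd c ` V)"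
    and openin_coords_preimage: "open U \<Longrightarrow> openin M {p \<in> chart_dom c. snd c p \<in> U}"
    and compactin_coords_preimage:
      "compact K \<Longrightarrow> K \<subseteq> chart_image c \<Longrightarrow> compactin M {p \<in> chart_dom c. snd c p \<in> K}"
proof -
  let ?X = "subtopology M (chart_dom c)" and ?Y = "top_of_set (chart_image c)"
  show o: "openin M (chart_dom c)" and oi: "open (chart_image c)"
    using assms by (auto simp: is_chart_def)
  have h: "homeomorphic_map ?X ?Y (snd c)" using assms by (simp add: is_chart_def)
  show s: "chart_dom c \<subseteq> topspace M" by (rule openin_subset[OF o])
  hence tX: "topspace ?X = chart_dom c" by (simp add: Int_absorb1)
  have inj: "inj_on (snd c) (chart_dom c)" using homeomorphic_imp_injective_map[OF h] tX by simp
  thus "p \<in> chart_dom c \<Longrightarrow> chart_inv c (snd c p) = p" by (simp add: chart_inv_def)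
  show "x \<in> chart_image c \<Longrightarrow> snd c (chart_inv c x) = x"
    and "x \<in> chart_image c \<Longrightarrow> chart_inv c x \<in> chart_dom c"
    by (simp_all add: chart_inv_def f_inv_into_f inv_into_into)
  show "open (snd c ` V)" if "openin M V" "V \<subseteq> chart_dom c"
  proof -
    have "openin ?X V" using that o by (simp add: openin_open_subtopology)
    hence "openin ?Y (snd c ` V)" using homeomorphic_imp_open_map[OF h] by (simp add: open_map_def)
    thus ?thesis using oi by (simp add: openin_open_eq)
  qed
  show "openin M {p \<in> chart_dom c. snd c p \<in> U}" if "open U"
  proof -
    have "openin ?Y (chart_image c \<inter> U)" using that by (simp add: openin_open_Int)
    hence "openin ?X {p \<in> topspace ?X. snd c p \<in> chart_image c \<inter> U}"
      by (rule openin_continuous_map_preimage[OF homeomorphic_imp_continuous_map[OF h]])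
    moreover have "{p \<in> topspace ?X. snd c p \<in> chart_image c \<inter> U} = {p \<in> chart_dom c. snd c p \<in> U}"
      unfolding tX by auto
    ultimately show ?thesis using o by (simp add: openin_open_subtopology)
  qed
  show "compactin M {p \<in> chart_dom c. snd c p \<in> K}" if "compact K" "K \<subseteq> chart_image c"
  proof -
    have "snd c ` {p \<in> chart_dom c. snd c p \<in> K} = K" using that(2) by auto
    hence "compactin ?Y (snd c ` {p \<in> chart_dom c. snd c p \<in> K})"
      using that by (simp add: compactin_subtopology)
    hence "compactin ?X {p \<in> chart_dom c. snd c p \<in> K}"
      by (subst (asm) homeomorphic_map_compactness[OF h]) (use s in \<open>auto simp: tX\<close>)
    thus ?thesis by (simp add: compactin_subtopology)
  qed
qed

section \<open>Transition maps of an atlas and extension of local data\<close>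

locale smooth_manifold_atlas =
  fixes M :: "'a topology" and A :: "('a, 'e::euclidean_space) chart set"
  assumes mfd: "smooth_manifold M A"
begin

lemma chart: "c \<in> A \<Longrightarrow> is_chart M c"
  using mfd by (simp add: smooth_manifold_def)

lemmas dom_subset = chart_dom_subset[OF chart]
lemmas openin_dom = openin_chart_dom[OF chart]
lemmas open_image = open_chart_image[OF chart]
lemmas inv_coords [simp] = chart_inv_coords[OF chart]
lemmas coords_inv [simp] = coords_chart_inv[OF chart]
lemmas inv_in_dom [simp] = chart_inv_in_dom[OF chart]
lemmas openin_preimage = openin_coords_preimage[OF chart]

lemma open_overlap: "c \<in> A \<Longrightarrow> c' \<in> A \<Longrightarrow> open (snd c ` (chart_dom c \<inter> chart_dom c'))"
  by (rule open_coords_image[OF chart]) (auto intro: openin_Int openin_dom)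

lemma smooth_transition:
  "c \<in> A \<Longrightarrow> c' \<in> A \<Longrightarrow> smooth_on (snd c ` (chart_dom c \<inter> chart_dom c')) (snd c' \<circ> chart_inv c)"
  using mfd unfolding smooth_manifold_def by blast

lemma transition_has_derivative:
  assumes "c \<in> A" "c' \<in> A" "p \<in> chart_dom c" "p \<in> chart_dom c'"
  shows "((snd c' \<circ> chart_inv c) has_derivative blinfun_apply (transition c c' p)) (at (snd c p))"
proof -
  have d: "((snd c' \<circ> chart_inv c) has_derivative
      frechet_derivative (snd c' \<circ> chart_inv c) (at (snd c p))) (at (snd c p))"
    by (rule smooth_on_has_derivative[OF smooth_transition]) (use assms in auto)
  thus ?thesis unfolding transition_def
    by (simp add: bounded_linear_Blinfun_apply[OF has_derivative_bounded_linear])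
qed

lemma has_derivative_change_chart:
  assumes "c \<in> A" "c' \<in> A" "p \<in> chart_dom c" "p \<in> chart_dom c'"
    and f: "((f \<circ> chart_inv c) has_derivative D) (at (snd c p))"
  shows "((f \<circ> chart_inv c') has_derivative (\<lambda>v. D (transition c' c p v))) (at (snd c' p))"
proof (rule has_derivative_transform_within_open)
  have "((f \<circ> chart_inv c) has_derivative D) (at ((snd c \<circ> chart_inv c') (snd c' p)))"
    using f assms by simp
  from has_derivative_compose[OF transition_has_derivative[of c' c p] this]
  show "((\<lambda>x. (f \<circ> chart_inv c) ((snd c \<circ> chart_inv c') x)) has_derivative
      (\<lambda>v. D (transition c' c p v))) (at (snd c' p))"
    using assms by simp
  show "open (snd c' ` (chart_dom c' \<inter> chart_dom c))" using assms by (simp add: open_overlap)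
qed (use assms in auto)

lemma transition_trans:
  assumes "c \<in> A" "c' \<in> A" "c'' \<in> A" "p \<in> chart_dom c" "p \<in> chart_dom c'" "p \<in> chart_dom c''"
  shows "transition c c'' p v = transition c' c'' p (transition c c' p v)"
  using has_derivative_unique[OF transition_has_derivative[of c c'' p]
      has_derivative_change_chart[OF _ _ _ _ transition_has_derivative[of c' c'' p], of c]] assms
  by metis

lemma transition_self:
  assumes "c \<in> A" "p \<in> chart_dom c"
  shows "transition c c p v = v"
proof -
  have "((snd c \<circ> chart_inv c) has_derivative (\<lambda>v. v)) (at (snd c p))"
    by (rule has_derivative_transform_within_open[OF has_derivative_ident open_image[OF assms(1)]])
       (use assms in auto)
  from has_derivative_unique[OF transition_has_derivative this] assms show ?thesis by metis
qed

text \<open>The form \<open>G * \<omega>\<close> of the chart \<open>c\<close> is pulled back to the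
  other charts and extended by 0. It stays smooth at the boundary of the domain of \<open>c\<close>
  because the points with coordinates in \<open>K\<close> form a compact set, which is closed as the
  manifold is Hausdorff.\<close>

lemma smooth_form_extension:
  assumes c: "c \<in> A" and K: "compact K" "K \<subseteq> chart_image c" "\<And>x. x \<notin> K \<Longrightarrow> G x = 0"
    and G: "smooth_on UNIV G" and \<omega>: "alt_multilinear k \<omega>"
  shows "(\<lambda>c' q vs. if c' \<in> A \<and> q \<in> chart_dom c' \<and> q \<in> chart_dom c
      then G (snd c q) * \<omega> (map (transition c' c q) vs) else 0) \<in> forms A k"
    (is "?\<beta> \<in> _")
  unfolding forms_def alt_fields_def mem_Collect_eq
proof (intro conjI allI impI ballI)
  fix c' q assume "c' \<in> A \<and> q \<in> chart_dom c'"
  \<comment> \<open>A multiple with factor 0 exhibits the zero map as alternating, for the points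
    outside of \<open>c\<close>.\<close>
  moreover have "alt_multilinear k (\<lambda>vs. 0 * \<omega> (map id vs))"
    by (rule alt_multilinear_map[OF \<omega>]) (simp add: linear_id)
  ultimately show "alt_multilinear k (?\<beta> c' q)"
    by (cases "q \<in> chart_dom c") (simp_all add: alt_multilinear_map[OF \<omega>] bounded_linear.linear[OF blinfun.bounded_linear_right])
next
  fix c' q assume "\<not> (c' \<in> A \<and> q \<in> chart_dom c')"
  thus "?\<beta> c' q = (\<lambda>vs. 0)" by auto
next
  fix c1 c2 q vs assume *: "c1 \<in> A" "c2 \<in> A" "q \<in> chart_dom c1 \<inter> chart_dom c2"
  have "blinfun_apply (transition c2 c q) \<circ> blinfun_apply (transition c1 c2 q) = transition c1 c q"
    if "q \<in> chart_dom c"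
    using transition_trans[of c1 c2 c q] * c that by (simp add: fun_eq_iff)
  thus "?\<beta> c1 q vs = ?\<beta> c2 q (map (transition c1 c2 q) vs)" using * by simp
next
  fix c' :: "('a, 'e) chart" and vs assume c': "c' \<in> A"
  show "smooth_on (chart_image c') (\<lambda>x. ?\<beta> c' (chart_inv c' x) vs)"
  proof (rule smooth_on_local)
    fix x assume x: "x \<in> chart_image c'"
    let ?q = "chart_inv c' x" and ?\<tau> = "snd c \<circ> chart_inv c'"
    define Kp where "Kp = {p \<in> chart_dom c. snd c p \<in> K}"
    show "\<exists>U. open U \<and> x \<in> U \<and> smooth_on U (\<lambda>x. ?\<beta> c' (chart_inv c' x) vs)"
    proof (cases "length vs = k \<and> ?q \<in> chart_dom c")
      case True
      let ?U = "snd c' ` (chart_dom c' \<inter> chart_dom c)"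
      have U: "open ?U" using c c' by (simp add: open_overlap)
      have \<tau>: "smooth_on ?U ?\<tau>" using c c' by (simp add: smooth_transition)
      have d\<tau>: "smooth_on ?U (\<lambda>y. frechet_derivative ?\<tau> (at y) v)" for v
        by (rule smooth_on_frechet_derivative[OF \<tau>])
      have "smooth_on ?U (\<lambda>y. G (?\<tau> y))"
        by (rule smooth_on_compose[OF U open_UNIV _ G \<tau>]) simp
      moreover have "smooth_on ?U (\<lambda>y. \<omega> ([] @ map (\<lambda>f. f y) (map (\<lambda>v y. frechet_derivative ?\<tau> (at y) v) vs)))"
        by (rule smooth_on_multilinear[OF U, of _ _ k])
           (use True d\<tau> d\<tau>[unfolded comp_def] in \<open>auto intro: alt_multilinear_linear[OF \<omega>]\<close>)
      ultimately have "smooth_on ?U (\<lambda>y. G (?\<tau> y) *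
          \<omega> ([] @ map (\<lambda>f. f y) (map (\<lambda>v y. frechet_derivative ?\<tau> (at y) v) vs)))"
        by (rule smooth_on_mult[OF U])
      hence "smooth_on ?U (\<lambda>x. ?\<beta> c' (chart_inv c' x) vs)"
      proof (rule smooth_on_cong[OF U, rotated])
        fix y assume y: "y \<in> ?U"
        then obtain q where q: "q \<in> chart_dom c'" "q \<in> chart_dom c" "y = snd c' q" by blast
        have "blinfun_apply (transition c' c q) = frechet_derivative ?\<tau> (at (snd c' q))"
          by (rule frechet_derivative_at[OF transition_has_derivative]) (use q c c' in auto)
        thus "G (?\<tau> y) * \<omega> ([] @ map (\<lambda>f. f y) (map (\<lambda>v y. frechet_derivative ?\<tau> (at y) v) vs)) =
            ?\<beta> c' (chart_inv c' y) vs"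
          using q c c' by (simp add: comp_def)
      qed
      thus ?thesis using U True x c' by (intro exI[of _ ?U]) (auto intro!: image_eqI[of _ _ ?q])
    next
      case False
      \<comment> \<open>Away from \<open>Kp\<close> the form vanishes. On a list \<open>vs\<close>
        of the wrong length it vanishes everywhere, so that nothing is removed.\<close>
      let ?U = "snd c' ` (chart_dom c' - (if length vs = k then Kp else {}))"
      have "closedin M Kp" unfolding Kp_def
        using mfd compactin_coords_preimage[OF chart[OF c] K(1,2)]
        by (intro compactin_imp_closedin) (auto simp: smooth_manifold_def)
      hence U: "open ?U" using c'
        by (intro open_coords_image[OF chart]) (auto intro: openin_diff openin_dom)
      have K': "x \<in> K" if "G x \<noteq> 0" for x using that K(3) by blast
      have z: "\<omega> ws = 0" if "length ws \<noteq> k" for ws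
        using \<omega> that by (simp add: alt_multilinear_def)
      have "smooth_on ?U (\<lambda>x. ?\<beta> c' (chart_inv c' x) vs)"
        by (rule smooth_on_cong[OF U _ smooth_on_const[OF U, of 0]])
           (use c c' K' z in \<open>auto simp: Kp_def split: if_splits\<close>)
      thus ?thesis using U False x c'
        by (intro exI[of _ ?U]) (auto simp: Kp_def intro!: image_eqI[of _ _ ?q])
    qed
  qed
qed

text \<open>\<open>u\<close> is multiplied by a bump function that vanishes outside a closed ball in
  the image of \<open>c\<close>; \<open>V\<close> corresponds to a neighbourhood on which the bump
  function is 1.\<close>

lemma form_extension:
  assumes c: "c \<in> A" and p: "p \<in> chart_dom c"
    and u: "smooth_on UNIV u" and \<omega>: "alt_multilinear k \<omega>"
  obtains \<beta> V where "\<beta> \<in> forms A k" "openin M V" "p \<in> V" "V \<subseteq> chart_dom c"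
    "\<And>q vs. q \<in> V \<Longrightarrow> \<beta> c q vs = u (snd c q) * \<omega> vs"
proof -
  obtain r where r: "r > 0" "cball (snd c p) r \<subseteq> chart_image c"
    using open_image[OF c] p open_contains_cball by blast
  obtain \<psi> :: "'e \<Rightarrow> real" and U where \<psi>: "smooth_on UNIV \<psi>" "\<forall>x. x \<notin> cball (snd c p) r \<longrightarrow> \<psi> x = 0"
      "open U" "snd c p \<in> U" "\<forall>x\<in>U. \<psi> x = 1"
    using exists_bump[OF r(1), of "snd c p"] by blast
  have "smooth_on UNIV (\<lambda>x. \<psi> x * u x)" using \<psi>(1) u by (intro smooth_on_mult) auto
  from smooth_form_extension[OF c compact_cball r(2) _ this \<omega>] \<psi>(2)
  have "(\<lambda>c' q vs. if c' \<in> A \<and> q \<in> chart_dom c' \<and> q \<in> chart_dom c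
      then (\<psi> (snd c q) * u (snd c q)) * \<omega> (map (transition c' c q) vs) else 0) \<in> forms A k" by simp
  thus ?thesis
    by (rule that[OF _ openin_preimage[OF c \<psi>(3)]])
       (use c p \<psi> in \<open>auto simp: transition_self map_idI\<close>)
qed

text \<open>A function is a 0-form evaluated at the empty list, and the transformation law makes
  this value independent of the chart. So \<open>form_extension\<close> applies, with
  \<open>\<omega>\<close> equal to 1 at \<open>[]\<close>.\<close>

lemma function_extension:
  assumes c: "c \<in> A" and p: "p \<in> chart_dom c" and u: "smooth_on UNIV u"
  obtains h V where "h \<in> smooth_functions M A" "openin M V" "p \<in> V" "V \<subseteq> chart_dom c"
    "\<And>q. q \<in> V \<Longrightarrow> h q = u (snd c q)"
proof -
  have "alt_multilinear 0 (\<lambda>vs::'e list. if vs = [] then 1 else 0)" by (simp add: alt_multilinear_def)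
  then obtain \<beta> V where \<beta>: "\<beta> \<in> forms A 0" and V: "openin M V" "p \<in> V" "V \<subseteq> chart_dom c"
    and \<beta>V: "\<And>q vs. q \<in> V \<Longrightarrow> \<beta> c q vs = u (snd c q) * (if vs = [] then 1 else 0)"
    using form_extension[OF c p u] by blast
  define h where "h q = \<beta> (SOME c'. c' \<in> A \<and> q \<in> chart_dom c') q []" for q
  have h: "h q = \<beta> c' q []" if "c' \<in> A" "q \<in> chart_dom c'" for c' q
  proof -
    let ?c = "SOME c'. c' \<in> A \<and> q \<in> chart_dom c'"
    have "?c \<in> A \<and> q \<in> chart_dom ?c" by (rule someI[of _ c']) (use that in simp)
    hence "\<beta> ?c q [] = \<beta> c' q (map (transition ?c c' q) [])"
      using \<beta> that unfolding forms_def alt_fields_def by blast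
    thus ?thesis by (simp add: h_def)
  qed
  have "h \<in> smooth_functions M A"
    unfolding smooth_functions_def mem_Collect_eq
  proof (intro conjI ballI allI impI)
    fix c' assume c': "c' \<in> A"
    have *: "smooth_on (chart_image c') (\<lambda>x. \<beta> c' (chart_inv c' x) [])"
      using \<beta> c' unfolding forms_def alt_fields_def by blast
    thus "smooth_on (chart_image c') (h \<circ> chart_inv c')"
      using c' by (intro smooth_on_cong[OF open_image[OF c'] _ *]) (auto simp: h)
  next
    fix q assume "q \<notin> topspace M"
    hence "\<not> (c' \<in> A \<and> q \<in> chart_dom c')" for c' using dom_subset by blast
    hence "\<beta> c' q = (\<lambda>vs. 0)" for c' using \<beta> unfolding forms_def alt_fields_def by blast
    thus "h q = 0" by (simp add: h_def)
  qed
  moreover have "h q = u (snd c q)" if "q \<in> V" for q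
    using that V(3) h[OF c, of q] \<beta>V[OF that] by auto
  ultimately show ?thesis using that V by blast
qed

end

section \<open>The fundamental identity in a chart\<close>

context smooth_manifold_atlas
begin

lemma function_family_extension:
  fixes m :: nat
  assumes c: "c \<in> A" and p: "p \<in> chart_dom c" and u: "\<And>i. i < m \<Longrightarrow> smooth_on UNIV (u i)"
  shows "\<exists>f V. openin M V \<and> p \<in> V \<and> V \<subseteq> chart_dom c \<and>
    (\<forall>i<m. f i \<in> smooth_functions M A \<and> (\<forall>q\<in>V. f i q = u i (snd c q)))"
  using u
proof (induction m)
  case 0
  then show ?case using openin_dom[OF c] p by blast
next
  case (Suc m)
  obtain f V where f: "openin M V" "p \<in> V" "V \<subseteq> chart_dom c"
    "\<forall>i<m. f i \<in> smooth_functions M A \<and> (\<forall>q\<in>V. f i q = u i (snd c q))"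
    using Suc.IH Suc.prems less_SucI by blast
  have "smooth_on UNIV (u m)" by (rule Suc.prems) simp
  then obtain h W where h: "h \<in> smooth_functions M A" "openin M W" "p \<in> W" "W \<subseteq> chart_dom c"
      "\<And>q. q \<in> W \<Longrightarrow> h q = u m (snd c q)"
    by (rule function_extension[OF c p]) (rule that, (assumption | simp)+)
  show ?case
    by (rule exI[of _ "f(m := h)"], rule exI[of _ "V \<inter> W"])
       (use f h in \<open>auto simp: less_Suc_eq\<close>)
qed

lemma has_derivative_in_chart:
  assumes "c \<in> A" "openin M V" "V \<subseteq> chart_dom c" "q \<in> V" "\<And>q. q \<in> V \<Longrightarrow> h q = u (snd c q)"
    and "(u has_derivative D) (at (snd c q))"
  shows "((h \<circ> chart_inv c) has_derivative D) (at (snd c q))"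
proof (rule has_derivative_transform_within_open[OF assms(6)])
  show "open (snd c ` V)" using assms by (intro open_coords_image[OF chart])
qed (use assms in \<open>auto simp: subset_iff\<close>)

end

section \<open>The Nambu-Poisson tensor and its bracket in coordinates\<close>

locale nambu_poisson =
  fixes M :: "'a topology" and A :: "('a, 'e::euclidean_space) chart set"
    and \<Lambda> :: "('a, 'e, 'e \<Rightarrow>\<^sub>L real) field" and n :: nat
  assumes np: "nambu_poisson_manifold M A n \<Lambda>" and n3: "n \<ge> 3"

sublocale nambu_poisson \<subseteq> smooth_manifold_atlas M A
  by unfold_locales (use np in \<open>simp add: nambu_poisson_manifold_def\<close>)

context nambu_poisson
begin

lemma
  assumes "c \<in> A"
  shows \<Lambda>_alt: "p \<in> chart_dom c \<Longrightarrow> alt_multilinear n (\<Lambda> c p)"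
    and \<Lambda>_change: "c' \<in> A \<Longrightarrow> p \<in> chart_dom c \<Longrightarrow> p \<in> chart_dom c' \<Longrightarrow>
      \<Lambda> c p as = \<Lambda> c' p (map (\<lambda>a. a o\<^sub>L transition c' c p) as)"
    and \<Lambda>_smooth: "smooth_on (chart_image c) (\<lambda>x. \<Lambda> c (chart_inv c x) as)"
  using np assms unfolding nambu_poisson_manifold_def multivectors_def alt_fields_def by blast+

lemma \<Lambda>_outside: "\<not> (c \<in> A \<and> p \<in> chart_dom c) \<Longrightarrow> \<Lambda> c p = (\<lambda>as. 0)"
  using np unfolding nambu_poisson_manifold_def multivectors_def alt_fields_def by blast

text \<open>The differentials in the chart \<open>c0\<close> chosen by \<open>SOME\<close> are those
  in \<open>c\<close> composed with the transition, and \<Lambda> transforms accordingly. Only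
  derivatives at \<open>q\<close> enter, so that an entry of \<open>fs\<close> may itself be a
  bracket.\<close>

lemma nambu_bracket_in_chart:
  assumes c: "c \<in> A" "q \<in> chart_dom c" and l: "length fs = length ds"
    and d: "\<And>i. i < length fs \<Longrightarrow>
      ((fs ! i \<circ> chart_inv c) has_derivative blinfun_apply (ds ! i)) (at (snd c q))"
  shows "nambu_bracket M A \<Lambda> fs q = \<Lambda> c q ds"
proof -
  define c0 where "c0 = (SOME c. c \<in> A \<and> q \<in> chart_dom c)"
  have "c0 \<in> A \<and> q \<in> chart_dom c0" unfolding c0_def by (rule someI[of _ c]) (use c in simp)
  hence c0: "c0 \<in> A" "q \<in> chart_dom c0" by auto
  have "differential c0 (fs ! i) q = ds ! i o\<^sub>L transition c0 c q" if "i < length fs" for i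
  proof -
    have "((fs ! i \<circ> chart_inv c0) has_derivative blinfun_apply (ds ! i o\<^sub>L transition c0 c q)) (at (snd c0 q))"
    proof -
      have "blinfun_apply (ds ! i o\<^sub>L transition c0 c q) =
          (\<lambda>v. blinfun_apply (ds ! i) (blinfun_apply (transition c0 c q) v))" by (rule ext) simp
      thus ?thesis using has_derivative_change_chart[OF c(1) c0(1) c(2) c0(2) d[OF that]] by simp
    qed
    from frechet_derivative_at[OF this] show ?thesis
      unfolding differential_def chart_deriv_def by (metis blinfun_apply_inverse)
  qed
  hence "map (\<lambda>f. differential c0 f q) fs = map (\<lambda>a. a o\<^sub>L transition c0 c q) ds"
    using l by (intro nth_equalityI) auto
  moreover have "q \<in> topspace M" using c dom_subset by blast
  ultimately show ?thesis
    unfolding nambu_bracket_def using \<Lambda>_change[OF c(1) c0(1) c(2) c0(2)] by (simp add: Let_def flip: c0_def)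
qed

text \<open>The identity is applied to global functions that near \<open>p\<close> are, in
  coordinates, the \<open>u j\<close> and the linear functions \<open>cs ! i\<close>. The inner
  brackets are then \<Lambda> evaluated on their differentials, so \<open>D\<close> and
  \<open>E i\<close> are the differentials of the inner brackets at \<open>p\<close>.\<close>

lemma fundamental_identity_in_chart:
  assumes c: "c \<in> A" "p \<in> chart_dom c"
    and u: "\<And>j. j < n - 1 \<Longrightarrow> smooth_on UNIV (u j)"
    and du: "\<And>j x. j < n - 1 \<Longrightarrow> (u j has_derivative blinfun_apply (du j x)) (at x)"
    and l: "length cs = n"
    and D: "((\<lambda>x. \<Lambda> c (chart_inv c x) cs) has_derivative blinfun_apply D) (at (snd c p))"
    and E: "\<And>i. i < n \<Longrightarrow> ((\<lambda>x. \<Lambda> c (chart_inv c x) (map (\<lambda>j. du j x) [0..<n - 1] @ [cs ! i]))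
      has_derivative blinfun_apply (E i)) (at (snd c p))"
  shows "\<Lambda> c p (map (\<lambda>j. du j (snd c p)) [0..<n - 1] @ [D]) = (\<Sum>i<n. \<Lambda> c p (cs[i := E i]))"
proof -
  have sm: "smooth_on UNIV (blinfun_apply (cs ! i))" for i
    using smooth_on_bounded_linear[OF blinfun.bounded_linear_right open_UNIV smooth_on_id] by simp
  have "\<exists>f V. openin M V \<and> p \<in> V \<and> V \<subseteq> chart_dom c \<and>
      (\<forall>i<n - 1. f i \<in> smooth_functions M A \<and> (\<forall>q\<in>V. f i q = u i (snd c q)))"
    by (rule function_family_extension[OF c]) (rule u)
  then obtain f V where f: "openin M V" "p \<in> V" "V \<subseteq> chart_dom c"
      "\<forall>i<n - 1. f i \<in> smooth_functions M A \<and> (\<forall>q\<in>V. f i q = u i (snd c q))"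
    by (elim exE conjE) (rule that)
  have "\<exists>g W. openin M W \<and> p \<in> W \<and> W \<subseteq> chart_dom c \<and>
      (\<forall>i<n. g i \<in> smooth_functions M A \<and> (\<forall>q\<in>W. g i q = blinfun_apply (cs ! i) (snd c q)))"
    by (rule function_family_extension[OF c]) (rule sm)
  then obtain g W where g: "openin M W" "p \<in> W" "W \<subseteq> chart_dom c"
      "\<forall>i<n. g i \<in> smooth_functions M A \<and> (\<forall>q\<in>W. g i q = blinfun_apply (cs ! i) (snd c q))"
    by (elim exE conjE) (rule that)
  define U where "U = V \<inter> W"
  have U: "openin M U" "p \<in> U" "U \<subseteq> chart_dom c" using f g by (auto simp: U_def)
  have df: "((f i \<circ> chart_inv c) has_derivative blinfun_apply (du i (snd c q))) (at (snd c q))"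
    if "i < n - 1" "q \<in> U" for i q
    by (rule has_derivative_in_chart[OF c(1) U(1,3) that(2) _ du[OF that(1)]]) (use f that in \<open>auto simp: U_def\<close>)
  have dg: "((g i \<circ> chart_inv c) has_derivative blinfun_apply (cs ! i)) (at (snd c q))"
    if "i < n" "q \<in> U" for i q
    by (rule has_derivative_in_chart[OF c(1) U(1,3) that(2) _ bounded_linear_imp_has_derivative[OF blinfun.bounded_linear_right]])
       (use g that in \<open>auto simp: U_def\<close>)
  let ?fs = "map f [0..<n - 1]" and ?gs = "map g [0..<n]"
  let ?G = "nambu_bracket M A \<Lambda> ?gs" and ?F = "\<lambda>i. nambu_bracket M A \<Lambda> (?fs @ [g i])"
  \<comment> \<open>The inner brackets are differentiated afterwards, so they are computed on all of
    \<open>U\<close>.\<close>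
  have G: "?G q = \<Lambda> c (chart_inv c (snd c q)) cs" if "q \<in> U" for q
    using nambu_bracket_in_chart[of c q ?gs cs] dg that l U c by auto
  have F: "?F i q = \<Lambda> c (chart_inv c (snd c q)) (map (\<lambda>j. du j (snd c q)) [0..<n - 1] @ [cs ! i])"
    if "q \<in> U" "i < n" for q i
  proof -
    have "?F i q = \<Lambda> c q (map (\<lambda>j. du j (snd c q)) [0..<n - 1] @ [cs ! i])"
      using that U c by (intro nambu_bracket_in_chart) (auto simp: nth_append df dg)
    thus ?thesis using that U c by auto
  qed
  have dG: "((?G \<circ> chart_inv c) has_derivative blinfun_apply D) (at (snd c p))"
    by (rule has_derivative_in_chart[OF c(1) U(1,3,2) G D])
  have dF: "((?F i \<circ> chart_inv c) has_derivative blinfun_apply (E i)) (at (snd c p))" if "i < n" for i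
    by (rule has_derivative_in_chart[OF c(1) U(1,3,2) _ E[OF that]]) (rule F[OF _ that])
  have "nambu_bracket M A \<Lambda> (?fs @ [?G]) p =
      (\<Sum>i<n. nambu_bracket M A \<Lambda> (?gs[i := nambu_bracket M A \<Lambda> (?fs @ [?gs ! i])]) p)"
  proof -
    have "set ?fs \<subseteq> smooth_functions M A \<and> length ?fs = n - 1 \<and>
        set ?gs \<subseteq> smooth_functions M A \<and> length ?gs = n" using f g by auto
    moreover have "p \<in> topspace M" using c dom_subset by blast
    ultimately show ?thesis using np unfolding nambu_poisson_manifold_def by blast
  qed
  also have "nambu_bracket M A \<Lambda> (?fs @ [?G]) p = \<Lambda> c p (map (\<lambda>j. du j (snd c p)) [0..<n - 1] @ [D])"
    using c U by (intro nambu_bracket_in_chart) (auto simp: nth_append df dG)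
  also have "(\<Sum>i<n. nambu_bracket M A \<Lambda> (?gs[i := nambu_bracket M A \<Lambda> (?fs @ [?gs ! i])]) p) =
      (\<Sum>i<n. \<Lambda> c p (cs[i := E i]))"
  proof (rule sum.cong)
    fix i assume i: "i \<in> {..<n}"
    have "((?gs[i := ?F i] ! j \<circ> chart_inv c) has_derivative blinfun_apply (cs[i := E i] ! j)) (at (snd c p))"
      if "j < n" for j
      using that i l dg[OF that U(2)] dF[of i] by (cases "j = i") auto
    thus "nambu_bracket M A \<Lambda> (?gs[i := nambu_bracket M A \<Lambda> (?fs @ [?gs ! i])]) p = \<Lambda> c p (cs[i := E i])"
      using i c l by (intro nambu_bracket_in_chart) auto
  qed simp
  finally show ?thesis .
qed

text \<open>The differential at \<open>p\<close> of the component of \<Lambda> on covectors that are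
  constant in the chart \<open>c\<close>. It depends on the chart and is not a tensor.\<close>

definition \<Lambda>_deriv :: "('a, 'e) chart \<Rightarrow> 'a \<Rightarrow> ('e \<Rightarrow>\<^sub>L real) list \<Rightarrow> 'e \<Rightarrow>\<^sub>L real" where
  "\<Lambda>_deriv c p as = Blinfun (frechet_derivative (\<lambda>x. \<Lambda> c (chart_inv c x) as) (at (snd c p)))"

lemma \<Lambda>_has_derivative:
  assumes "c \<in> A" "p \<in> chart_dom c"
  shows "((\<lambda>x. \<Lambda> c (chart_inv c x) as) has_derivative blinfun_apply (\<Lambda>_deriv c p as)) (at (snd c p))"
proof -
  have d: "((\<lambda>x. \<Lambda> c (chart_inv c x) as) has_derivative
      frechet_derivative (\<lambda>x. \<Lambda> c (chart_inv c x) as) (at (snd c p))) (at (snd c p))"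
    by (rule smooth_on_has_derivative[OF \<Lambda>_smooth]) (use assms in auto)
  thus ?thesis
    by (simp add: \<Lambda>_deriv_def bounded_linear_Blinfun_apply[OF has_derivative_bounded_linear])
qed

text \<open>Functions that are linear in the chart have constant differentials, so that only the
  components of \<Lambda> get differentiated. This is the first order part of the fundamental
  identity.\<close>

lemma fundamental_identity_linear:
  assumes c: "c \<in> A" "p \<in> chart_dom c" and l: "length as = n - 1" "length cs = n"
  shows "\<Lambda> c p (as @ [\<Lambda>_deriv c p cs]) = (\<Sum>i<n. \<Lambda> c p (cs[i := \<Lambda>_deriv c p (as @ [cs ! i])]))"
proof -
  have as: "map (\<lambda>j. as ! j) [0..<n - 1] = as" using l(1) map_nth[of as] by (simp only:)
  have sm: "smooth_on UNIV (blinfun_apply (as ! i))" for i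
    using smooth_on_bounded_linear[OF blinfun.bounded_linear_right open_UNIV smooth_on_id] by simp
  have E: "((\<lambda>x. \<Lambda> c (chart_inv c x) (map (\<lambda>j. as ! j) [0..<n - 1] @ [cs ! i])) has_derivative
      blinfun_apply (\<Lambda>_deriv c p (as @ [cs ! i]))) (at (snd c p))" for i
    unfolding as by (rule \<Lambda>_has_derivative[OF c])
  show ?thesis
    using fundamental_identity_in_chart[OF c sm
        bounded_linear_imp_has_derivative[OF blinfun.bounded_linear_right] l(2) \<Lambda>_has_derivative[OF c] E]
    unfolding as .
qed

text \<open>
  Second derivatives enter only on the right hand side of the fundamental identity. Taking for the
  \<open>k\<close>-th function half the square of a coordinate that vanishes at \<open>p\<close> isolates them.
\<close>

lemma fundamental_identity_quadratic:
  assumes c: "c \<in> A" "p \<in> chart_dom c" and l: "length as = n - 1" "length cs = n" and k: "k < n - 1"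
  shows "(\<Sum>i<n. \<Lambda> c p (as @ [cs ! i]) * \<Lambda> c p (cs[i := as ! k])) = 0"
proof -
  note alt = \<Lambda>_alt[OF c]
  let ?x0 = "snd c p" and ?a = "as ! k"
  define u where "u j x = (if j = k then (?a (x - ?x0))\<^sup>2 / 2 else blinfun_apply (as ! j) x)" for j x
  define du where "du j x = (if j = k then ?a (x - ?x0) *\<^sub>R ?a else as ! j)" for j x
  have lin: "smooth_on UNIV (\<lambda>x. blinfun_apply a (x + y))" for a :: "'e \<Rightarrow>\<^sub>L real" and y
    by (intro smooth_on_bounded_linear[OF blinfun.bounded_linear_right] smooth_on_add smooth_on_id smooth_on_const) auto
  have su: "smooth_on UNIV (u j)" for j
  proof (cases "j = k")
    case True
    have "smooth_on UNIV (\<lambda>x. (?a (x + - ?x0) * ?a (x + - ?x0)) * (1 / 2))"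
      by (intro smooth_on_mult lin smooth_on_const) auto
    then show ?thesis using True by (simp add: u_def[abs_def] power2_eq_square)
  next
    case False
    then show ?thesis using lin[of "as ! j" 0] by (simp add: u_def[abs_def])
  qed
  have du': "(u j has_derivative blinfun_apply (du j x)) (at x)" for j x
  proof (cases "j = k")
    case True
    have "((\<lambda>x. (?a (x - ?x0))\<^sup>2 / 2) has_derivative (\<lambda>v. ?a (x - ?x0) * ?a v)) (at x)"
      by (auto intro!: derivative_eq_intros simp: fun_eq_iff)
    then show ?thesis using True by (simp add: u_def[abs_def] du_def scaleR_blinfun.rep_eq)
  next
    case False
    then show ?thesis
      by (simp add: u_def[abs_def] du_def bounded_linear_imp_has_derivative[OF blinfun.bounded_linear_right])
  qed
  have upd: "map (\<lambda>j. du j x) [0..<n - 1] = as[k := ?a (x - ?x0) *\<^sub>R ?a]" for x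
    using l k by (intro nth_equalityI) (auto simp: du_def nth_list_update)
  have sc: "\<Lambda> c q (as[k := r *\<^sub>R ?a] @ [b]) = r * \<Lambda> c q (as @ [b])" if "q \<in> chart_dom c" for q r b
  proof -
    have "linear (\<lambda>v. \<Lambda> c q ((as @ [b])[k := v]))"
      by (rule alt_multilinear_linear[OF \<Lambda>_alt[OF c(1) that]]) (use l k in auto)
    from linear_scale[OF this, of r ?a] show ?thesis using l k by (simp add: list_update_append)
  qed
  \<comment> \<open>Product rule: the factor \<open>?a (x - ?x0)\<close> vanishes at
    \<open>?x0\<close>, so only its differential \<open>?a\<close> is left, times the value of
    \<Lambda> at \<open>p\<close>.\<close>
  have E: "((\<lambda>x. \<Lambda> c (chart_inv c x) (map (\<lambda>j. du j x) [0..<n - 1] @ [cs ! i]))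
      has_derivative blinfun_apply (\<Lambda> c p (as @ [cs ! i]) *\<^sub>R ?a)) (at ?x0)" for i
  proof (rule has_derivative_transform_within_open)
    let ?b = "\<Lambda>_deriv c p (as @ [cs ! i])"
    have "((\<lambda>x. ?a (x - ?x0) * \<Lambda> c (chart_inv c x) (as @ [cs ! i])) has_derivative
        (\<lambda>v. ?a (?x0 - ?x0) * ?b v + ?a v * \<Lambda> c (chart_inv c ?x0) (as @ [cs ! i]))) (at ?x0)"
      by (intro has_derivative_mult \<Lambda>_has_derivative[OF c]) (auto intro!: derivative_eq_intros)
    thus "((\<lambda>x. ?a (x - ?x0) * \<Lambda> c (chart_inv c x) (as @ [cs ! i]))
        has_derivative blinfun_apply (\<Lambda> c p (as @ [cs ! i]) *\<^sub>R ?a)) (at ?x0)"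
      using c by (simp add: scaleR_blinfun.rep_eq mult.commute blinfun.zero_right)
    show "open (chart_image c)" by (rule open_image[OF c(1)])
  qed (use c in \<open>auto simp del: upt_Suc One_nat_def simp: upd sc\<close>)
  have "\<Lambda> c p (map (\<lambda>j. du j ?x0) [0..<n - 1] @ [\<Lambda>_deriv c p cs]) =
      (\<Sum>i<n. \<Lambda> c p (cs[i := \<Lambda> c p (as @ [cs ! i]) *\<^sub>R ?a]))"
    by (rule fundamental_identity_in_chart[OF c su du' l(2) \<Lambda>_has_derivative[OF c] E])
  \<comment> \<open>On the left hand side, the differential of the \<open>k\<close>-th function
    vanishes at \<open>p\<close>.\<close>
  moreover have "\<Lambda> c p (map (\<lambda>j. du j ?x0) [0..<n - 1] @ [\<Lambda>_deriv c p cs]) = 0"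
    unfolding upd sc[OF c(2)] by (simp add: blinfun.zero_right)
  moreover have "\<Lambda> c p (cs[i := r *\<^sub>R ?a]) = r * \<Lambda> c p (cs[i := ?a])" if "i < n" for i r
    using linear_scale[OF alt_multilinear_linear[OF alt l(2) that], of r ?a] by simp
  ultimately show ?thesis by simp
qed

lemma quadratic_alt_\<Lambda>:
  assumes c: "c \<in> A" "p \<in> chart_dom c"
  shows "quadratic_alt (\<Lambda> c p) n"
proof
  fix as cs :: "('e \<Rightarrow>\<^sub>L real) list" and k
  assume *: "length as = n" "length cs = n" "k < n - 1" "as ! k = as ! (n - 1)"
  have "as[n - 1 := x] = take (n - 1) as @ [x]" for x
    using * n3 upd_conv_take_nth_drop[of "n - 1" as x] by simp
  thus "(\<Sum>i<n. \<Lambda> c p (as[n - 1 := cs ! i]) * \<Lambda> c p (cs[i := as ! (n - 1)])) = 0"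
    using fundamental_identity_quadratic[OF c, of "take (n - 1) as" cs k] * n3 by (simp del: One_nat_def)
qed (use \<Lambda>_alt[OF c] n3 in auto)

end

section \<open>The kernel of the contraction\<close>

lemma formsD:
  assumes "\<alpha> \<in> forms A k"
  shows "c \<in> A \<Longrightarrow> p \<in> chart_dom c \<Longrightarrow> alt_multilinear k (\<alpha> c p)"
    and "\<not> (c \<in> A \<and> p \<in> chart_dom c) \<Longrightarrow> \<alpha> c p = (\<lambda>vs. 0)"
    and "c \<in> A \<Longrightarrow> c' \<in> A \<Longrightarrow> p \<in> chart_dom c \<inter> chart_dom c' \<Longrightarrow>
      \<alpha> c p vs = \<alpha> c' p (map (transition c c' p) vs)"
    and "c \<in> A \<Longrightarrow> smooth_on (chart_image c) (\<lambda>x. \<alpha> c (chart_inv c x) vs)"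
  using assms unfolding forms_def alt_fields_def by blast+

lemma blinfun_basis_expansion:
  fixes a :: "'e::euclidean_space \<Rightarrow>\<^sub>L real"
  shows "(\<Sum>b\<in>Basis. blinfun_apply a b *\<^sub>R blinfun_inner_left b) = a"
  by (rule blinfun_euclidean_eqI)
     (auto simp: blinfun.sum_left blinfun.scaleR_left inner_Basis if_distrib cong: if_cong)

lemma alt_multilinear_append:
  assumes P: "alt_multilinear (Suc k) P"
  shows "alt_multilinear k (\<lambda>vs. P (vs @ [w]))"
  unfolding alt_multilinear_def
proof (intro conjI allI impI)
  fix vs :: "'a list" assume "length vs \<noteq> k"
  thus "P (vs @ [w]) = 0" using P unfolding alt_multilinear_def by simp
next
  fix vs :: "'a list" and i assume *: "length vs = k" "i < k"
  show "linear (\<lambda>v. P (vs[i := v] @ [w]))"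
    using alt_multilinear_linear[OF P, of "vs @ [w]" i] * by (simp add: list_update_append)
next
  fix vs :: "'a list" and i j assume *: "length vs = k" "i < j" "j < k" "vs ! i = vs ! j"
  show "P (vs @ [w]) = 0"
    by (rule alt_multilinear_eq_0[OF P, of _ i j]) (use * in \<open>auto simp: nth_append\<close>)
qed

lemma linear_alt_multilinear_snoc:
  assumes P: "alt_multilinear (Suc k) P" and l: "length vs = k"
  shows "linear (\<lambda>v. P (vs @ [v]))"
  using alt_multilinear_linear[OF P, of "vs @ [0]" k] by (simp flip: l)

context nambu_poisson
begin

lemma \<Lambda>_alt_Suc: "c \<in> A \<Longrightarrow> p \<in> chart_dom c \<Longrightarrow> alt_multilinear (Suc (n - 1)) (\<Lambda> c p)"
  using \<Lambda>_alt n3 by simp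

lemma sharp_ext_deriv_eq_0:
  assumes \<alpha>: "\<alpha> \<in> forms A (n - 1)" and ker: "sharp (n - 1) \<Lambda> \<alpha> = zero_field"
    and c: "c \<in> A" "p \<in> chart_dom c"
  shows "sharp n \<Lambda> (ext_deriv \<alpha>) c p [] = 0"
proof -
  define B where "B = {bs :: 'e list. set bs \<subseteq> Basis \<and> length bs = n - 1}"
  define d where "d = map (blinfun_inner_left :: 'e \<Rightarrow> 'e \<Rightarrow>\<^sub>L real)"
  define L where "L = \<Lambda> c p"
  define a where "a = \<alpha> c p"
  define Da where "Da bs = Blinfun (frechet_derivative (\<lambda>x. \<alpha> c (chart_inv c x) bs) (at (snd c p)))" for bs
  let ?DL = "\<Lambda>_deriv c p"
  have altL: "alt_multilinear n L" and altL': "alt_multilinear (Suc (n - 1)) L"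
    using \<Lambda>_alt[OF c] \<Lambda>_alt_Suc[OF c] by (simp_all add: L_def)
  have len: "length (d bs) = n - 1" if "bs \<in> B" for bs using that by (simp add: d_def B_def)
  have Da: "((\<lambda>x. \<alpha> c (chart_inv c x) bs) has_derivative blinfun_apply (Da bs)) (at (snd c p))" for bs
  proof -
    have "((\<lambda>x. \<alpha> c (chart_inv c x) bs) has_derivative
        frechet_derivative (\<lambda>x. \<alpha> c (chart_inv c x) bs) (at (snd c p))) (at (snd c p))"
      by (rule smooth_on_has_derivative[OF formsD(4)[OF \<alpha>]]) (use c in auto)
    thus ?thesis by (simp add: Da_def bounded_linear_Blinfun_apply[OF has_derivative_bounded_linear])
  qed
  \<comment> \<open>The kernel condition in components, at every point \<open>q\<close> and hence
    ready to be differentiated.\<close>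
  have K: "(\<Sum>bs\<in>B. \<alpha> c q bs * \<Lambda> c q (d bs @ [w])) = 0" for q w
    using fun_cong[OF fun_cong[OF fun_cong[OF ker, of c], of q], of "[w]"]
    by (simp add: sharp_def contract_def B_def d_def)
  \<comment> \<open>Differentiating \<open>K\<close> at \<open>p\<close> trades derivatives of
    \<Lambda> for derivatives of the coefficients of \<alpha>.\<close>
  have K': "(\<Sum>bs\<in>B. a bs *\<^sub>R ?DL (d bs @ [w])) = - (\<Sum>bs\<in>B. L (d bs @ [w]) *\<^sub>R Da bs)" for w
  proof -
    let ?x0 = "snd c p"
    have "((\<lambda>x. \<Sum>bs\<in>B. \<alpha> c (chart_inv c x) bs * \<Lambda> c (chart_inv c x) (d bs @ [w])) has_derivative
        (\<lambda>v. \<Sum>bs\<in>B. \<alpha> c (chart_inv c ?x0) bs * ?DL (d bs @ [w]) v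
          + Da bs v * \<Lambda> c (chart_inv c ?x0) (d bs @ [w]))) (at ?x0)"
      by (intro has_derivative_sum has_derivative_mult Da \<Lambda>_has_derivative[OF c])
    moreover have "((\<lambda>x. \<Sum>bs\<in>B. \<alpha> c (chart_inv c x) bs * \<Lambda> c (chart_inv c x) (d bs @ [w]))
        has_derivative (\<lambda>v. 0)) (at ?x0)"
      by (simp add: K)
    ultimately have "(\<lambda>v. \<Sum>bs\<in>B. \<alpha> c (chart_inv c ?x0) bs * ?DL (d bs @ [w]) v
          + Da bs v * \<Lambda> c (chart_inv c ?x0) (d bs @ [w])) = (\<lambda>v. 0)"
      by (rule has_derivative_unique)
    hence "(\<Sum>bs\<in>B. a bs * ?DL (d bs @ [w]) v + L (d bs @ [w]) * Da bs v) = 0" for v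
      using c by (simp add: fun_eq_iff a_def L_def mult.commute)
    hence "(\<Sum>bs\<in>B. a bs *\<^sub>R ?DL (d bs @ [w])) + (\<Sum>bs\<in>B. L (d bs @ [w]) *\<^sub>R Da bs) = 0"
      by (intro blinfun_eqI)
         (simp add: blinfun.sum_left blinfun.scaleR_left blinfun.add_left sum.distrib)
    thus ?thesis by (simp add: eq_neg_iff_add_eq_0)
  qed
  \<comment> \<open>Up to sign and a numerical factor, this sum is the contraction of \<Lambda> with
    the exterior derivative of \<alpha>.\<close>
  have main: "(\<Sum>bs\<in>B. L (d bs @ [Da bs])) = 0"
  proof (cases "\<exists>cs. length cs = n \<and> L cs \<noteq> 0")
    case False
    then show ?thesis using len n3 by (intro sum.neutral) auto
  next
    case True
    then obtain cs where cs: "length cs = n" "L cs \<noteq> 0" by blast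
    have lin: "linear (\<lambda>v. L (cs[i := v]))" if "i < n" for i
      by (rule alt_multilinear_linear[OF altL cs(1) that])
    \<comment> \<open>\<open>K\<close> is used with the covector \<open>?DL cs\<close>: this is the
      left hand side of the linear fundamental identity for \<open>d bs\<close>, contracted with
      \<alpha>.\<close>
    have "0 = (\<Sum>bs\<in>B. a bs * L (d bs @ [?DL cs]))" using K[of p] by (simp add: a_def L_def)
    also have "\<dots> = (\<Sum>bs\<in>B. \<Sum>i<n. a bs * L (cs[i := ?DL (d bs @ [cs ! i])]))"
      using fundamental_identity_linear[OF c len cs(1)] by (simp add: L_def sum_distrib_left)
    also have "\<dots> = (\<Sum>i<n. \<Sum>bs\<in>B. a bs * L (cs[i := ?DL (d bs @ [cs ! i])]))"
      by (rule sum.swap)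
    also have "\<dots> = (\<Sum>i<n. L (cs[i := \<Sum>bs\<in>B. a bs *\<^sub>R ?DL (d bs @ [cs ! i])]))"
      by (rule sum.cong) (simp_all add: linear_sum[OF lin] linear_scale[OF lin])
    \<comment> \<open>By \<open>K'\<close> with \<open>w = cs ! i\<close>. Up to a factor, the
      result is the value of
      \<open>\<Sum> i(dx\<^sub>J)\<Lambda> \<and> i(da\<^sub>J)\<Lambda>\<close> on
      \<open>cs\<close>.\<close>
    also have "\<dots> = (\<Sum>i<n. \<Sum>bs\<in>B. - (L (d bs @ [cs ! i]) * L (cs[i := Da bs])))"
      by (rule sum.cong)
         (simp_all add: K' linear_neg[OF lin] linear_sum[OF lin] linear_scale[OF lin] sum_negf)
    also have "\<dots> = (\<Sum>bs\<in>B. \<Sum>i<n. - (L (d bs @ [cs ! i]) * L (cs[i := Da bs])))"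
      by (rule sum.swap)
    \<comment> \<open>The Pluecker relation with \<open>x = Da bs\<close> collapses the sum over
      \<open>i\<close>.\<close>
    also have "\<dots> = (\<Sum>bs\<in>B. - (L (d bs @ [Da bs]) * L cs))"
      using quadratic_alt.pluecker[OF quadratic_alt_\<Lambda>[OF c] len cs(1)] cs(2)
      by (intro sum.cong) (simp_all add: L_def sum_negf)
    also have "\<dots> = - ((\<Sum>bs\<in>B. L (d bs @ [Da bs])) * L cs)"
      by (simp add: sum_negf sum_distrib_right)
    finally show ?thesis using cs(2) by simp
  qed
  let ?Bn = "{bs :: 'e list. set bs \<subseteq> Basis \<and> length bs = n}"
  let ?del = "\<lambda>i (vs :: 'e list). take i vs @ drop (Suc i) vs"
  \<comment> \<open>The \<open>i\<close>-th summand of the exterior derivative differentiates along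
    the \<open>i\<close>-th argument. Moving this argument to the end turns the contracted summand
    into \<open>main\<close>, up to sign, so the summands vanish one by one.\<close>
  have part: "(\<Sum>vs\<in>?Bn. Da (?del i vs) (vs ! i) * L (d vs)) = 0" if i: "i < n" for i
  proof -
    have "(\<Sum>vs\<in>?Bn. Da (?del i vs) (vs ! i) * L (d vs)) =
        (\<Sum>(bs, b)\<in>B \<times> Basis. Da bs b * L (d (take i bs @ b # drop i bs)))"
    proof (rule sum.reindex_bij_witness[where i = "\<lambda>(bs, b). take i bs @ b # drop i bs"
          and j = "\<lambda>vs. (?del i vs, vs ! i)"])
      fix vs :: "'e list" assume vs: "vs \<in> ?Bn"
      hence e: "take i vs @ vs ! i # drop (Suc i) vs = vs" using i by (simp add: id_take_nth_drop[symmetric])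
      thus "(case (?del i vs, vs ! i) of (bs, b) \<Rightarrow> take i bs @ b # drop i bs) = vs"
        using vs i by simp
      thus "(case (?del i vs, vs ! i) of (bs, b) \<Rightarrow> Da bs b * L (d (take i bs @ b # drop i bs)))
          = Da (?del i vs) (vs ! i) * L (d vs)"
        by simp
      show "(?del i vs, vs ! i) \<in> B \<times> Basis"
        using vs i set_take_subset[of i vs] set_drop_subset[of "Suc i" vs] nth_mem[of i vs]
        by (auto simp: B_def)
    next
      fix x assume x: "x \<in> B \<times> (Basis :: 'e set)"
      obtain bs b where [simp]: "x = (bs, b)" by (cases x)
      have l: "length bs = n - 1" using x by (simp add: B_def)
      show "(?del i (case x of (bs, b) \<Rightarrow> take i bs @ b # drop i bs),
          (case x of (bs, b) \<Rightarrow> take i bs @ b # drop i bs) ! i) = x"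
        using l i by (simp add: nth_append)
      show "(case x of (bs, b) \<Rightarrow> take i bs @ b # drop i bs) \<in> ?Bn"
        using x l i set_take_subset[of i bs] set_drop_subset[of i bs] by (auto simp: B_def)
    qed
    also have "\<dots> = (\<Sum>bs\<in>B. \<Sum>b\<in>Basis. Da bs b * ((-1) ^ (n - 1 - i) * L (d bs @ [blinfun_inner_left b])))"
    proof -
      have "L (d (take i bs @ b # drop i bs)) = (-1) ^ (n - 1 - i) * L (d bs @ [blinfun_inner_left b])"
        if "bs \<in> B" for bs b
        using alt_multilinear_insert[OF altL' len[OF that], of i] i by (simp add: d_def take_map drop_map)
      thus ?thesis by (simp add: sum.cartesian_product[symmetric])
    qed
    also have "\<dots> = (-1) ^ (n - 1 - i) * (\<Sum>bs\<in>B. \<Sum>b\<in>Basis. Da bs b * L (d bs @ [blinfun_inner_left b]))"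
      by (simp add: sum_distrib_left mult_ac)
    also have "(\<Sum>bs\<in>B. \<Sum>b\<in>Basis. Da bs b * L (d bs @ [blinfun_inner_left b])) = (\<Sum>bs\<in>B. L (d bs @ [Da bs]))"
    proof (rule sum.cong)
      fix bs assume "bs \<in> B"
      hence lin: "linear (\<lambda>v. L (d bs @ [v]))" by (intro linear_alt_multilinear_snoc[OF altL'] len)
      have "L (d bs @ [Da bs]) = L (d bs @ [\<Sum>b\<in>Basis. Da bs b *\<^sub>R blinfun_inner_left b])"
        by (simp add: blinfun_basis_expansion)
      thus "(\<Sum>b\<in>Basis. Da bs b * L (d bs @ [blinfun_inner_left b])) = L (d bs @ [Da bs])"
        by (simp add: linear_sum[OF lin] linear_scale[OF lin])
    qed simp
    finally show ?thesis by (simp add: main)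
  qed
  have ext: "ext_deriv \<alpha> c p vs = (\<Sum>i<n. (-1) ^ i * Da (?del i vs) (vs ! i))" if "length vs = n" for vs
  proof -
    have "chart_deriv c (\<lambda>q. \<alpha> c q ws) p = Da ws" for ws
      unfolding chart_deriv_def comp_def using frechet_derivative_at[OF Da, of ws] by simp
    thus ?thesis using that c by (simp add: ext_deriv_def)
  qed
  have "(\<Sum>vs\<in>?Bn. ext_deriv \<alpha> c p vs * L (d vs)) =
      (\<Sum>vs\<in>?Bn. \<Sum>i<n. (-1) ^ i * (Da (?del i vs) (vs ! i) * L (d vs)))"
    by (rule sum.cong) (simp_all add: ext sum_distrib_right mult.assoc)
  also have "\<dots> = (\<Sum>i<n. (-1) ^ i * (\<Sum>vs\<in>?Bn. Da (?del i vs) (vs ! i) * L (d vs)))"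
    by (subst sum.swap) (simp add: sum_distrib_left)
  also have "\<dots> = 0" by (simp add: part)
  finally show ?thesis by (simp add: sharp_def contract_def L_def d_def)
qed

text \<open>With \<open>X = 0\<close> the Lie derivative vanishes term by term, and
  \<open>sharp_ext_deriv_eq_0\<close> removes the remaining multiple of \<beta>.\<close>

lemma leibniz_bracket_eq_0:
  assumes \<alpha>: "\<alpha> \<in> forms A (n - 1)" and ker: "sharp (n - 1) \<Lambda> \<alpha> = zero_field"
    and \<beta>: "\<beta> \<in> forms A (n - 1)"
  shows "leibniz_bracket n \<Lambda> \<alpha> \<beta> = zero_field"
proof (intro ext)
  fix c p vs
  show "leibniz_bracket n \<Lambda> \<alpha> \<beta> c p vs = 0"
  proof (cases "c \<in> A \<and> p \<in> chart_dom c")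
    case False
    \<comment> \<open>\<open>lie_deriv\<close> tests \<open>p \<in> chart_dom c\<close> but not
      \<open>c \<in> A\<close>; for a chart outside of the atlas it vanishes because \<beta>
      does.\<close>
    have "lie_deriv zero_field \<beta> c p vs = 0"
    proof (cases "c \<in> A")
      case True
      then show ?thesis using False by (simp add: lie_deriv_def)
    next
      case False
      hence "\<beta> c = (\<lambda>p vs. 0)" using formsD(2)[OF \<beta>] by blast
      then show ?thesis by (simp add: lie_deriv_def chart_deriv_def comp_def)
    qed
    then show ?thesis using formsD(2)[OF \<beta> False] by (simp del: One_nat_def add: leibniz_bracket_def ker)
  next
    case True
    hence c: "c \<in> A" "p \<in> chart_dom c" by auto
    have "((\<lambda>x. \<beta> c (chart_inv c x) vs) has_derivative
        frechet_derivative (\<lambda>x. \<beta> c (chart_inv c x) vs) (at (snd c p))) (at (snd c p))"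
      by (rule smooth_on_has_derivative[OF formsD(4)[OF \<beta>]]) (use c in auto)
    hence "chart_deriv c (\<lambda>q. \<beta> c q vs) p 0 = 0"
      unfolding chart_deriv_def comp_def by (rule linear_0[OF has_derivative_linear])
    moreover have "\<beta> c p (vs[i := 0]) = 0" if "i < length vs" for i
    proof (cases "length vs = n - 1")
      case True
      then show ?thesis
        using linear_0[OF alt_multilinear_linear[OF formsD(1)[OF \<beta> c], of vs i]] that by simp
    next
      case False
      then show ?thesis using formsD(1)[OF \<beta> c] by (simp add: alt_multilinear_def)
    qed
    moreover have v: "vector_at zero_field c = (\<lambda>p. 0)" by (simp add: vector_at_def fun_eq_iff)
    moreover have "chart_deriv c (\<lambda>p. 0 :: 'e) p = (\<lambda>v. 0)" by (simp add: chart_deriv_def comp_def)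
    ultimately have "lie_deriv zero_field \<beta> c p vs = 0" by (simp add: lie_deriv_def)
    thus ?thesis using sharp_ext_deriv_eq_0[OF \<alpha> ker c] by (simp del: One_nat_def add: leibniz_bracket_def ker)
  qed
qed

section \<open>The center is contained in the kernel\<close>

text \<open>The contraction is linear in the covector that is left over, hence determined by the
  components that \<open>vector_at\<close> collects. In particular it vanishes where
  \<open>vector_at\<close> does.\<close>

lemma sharp_vector_at:
  assumes c: "c \<in> A" "p \<in> chart_dom c"
  shows "sharp (n - 1) \<Lambda> \<alpha> c p [a] = blinfun_apply a (vector_at (sharp (n - 1) \<Lambda> \<alpha>) c p)"
proof -
  let ?X = "\<lambda>a. sharp (n - 1) \<Lambda> \<alpha> c p [a]"
  have "linear (\<lambda>a. \<Lambda> c p (map blinfun_inner_left bs @ [a]))" if "length bs = n - 1" for bs :: "'e list"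
    by (rule linear_alt_multilinear_snoc[OF \<Lambda>_alt_Suc[OF c]]) (use that in simp)
  note lin = linear_add[OF this] linear_scale[OF this]
  have X: "linear ?X"
    unfolding sharp_def contract_def
    by (rule linearI)
       (simp_all add: lin algebra_simps sum.distrib add_divide_distrib sum_distrib_left cong: conj_cong)
  have "?X a = ?X (\<Sum>b\<in>Basis. blinfun_apply a b *\<^sub>R blinfun_inner_left b)"
    by (simp add: blinfun_basis_expansion)
  also have "\<dots> = (\<Sum>b\<in>Basis. blinfun_apply a b * ?X (blinfun_inner_left b))"
    by (simp del: One_nat_def add: linear_sum[OF X] linear_scale[OF X])
  also have "\<dots> = blinfun_apply a (vector_at (sharp (n - 1) \<Lambda> \<alpha>) c p)"
    by (simp add: vector_at_def blinfun.sum_right blinfun.scaleR_right mult.commute)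
  finally show ?thesis .
qed

text \<open>
  The bracket with \<open>h\<beta>\<close>, where \<open>h\<close> vanishes at \<open>p\<close>, takes at \<open>p\<close> the value \<open>X(h)\<beta>\<close> with
  \<open>X = #\<alpha>\<close>. If \<open>X \<noteq> 0\<close> at \<open>p\<close>, a suitable \<open>\<beta>\<close> with \<open>\<beta> \<noteq> 0\<close> at \<open>p\<close> is provided by \<open>\<Lambda>\<close> itself.
\<close>

lemma vector_at_center_eq_0:
  assumes \<alpha>: "\<alpha> \<in> leibniz_center A n \<Lambda>" and c: "c \<in> A" "p \<in> chart_dom c"
  shows "vector_at (sharp (n - 1) \<Lambda> \<alpha>) c p = 0"
proof (rule ccontr)
  let ?X = "sharp (n - 1) \<Lambda> \<alpha>"
  define v where "v = vector_at ?X c p"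
  \<comment> \<open>An affine function that vanishes at \<open>p\<close>; its derivative along
    \<open>v\<close> is \<open>v \<bullet> v\<close>, which is positive for
    \<open>v \<noteq> 0\<close>.\<close>
  let ?u = "\<lambda>x. (x - snd c p) \<bullet> v"
  assume "vector_at ?X c p \<noteq> 0"
  hence v: "v \<noteq> 0" by (simp add: v_def)
  then obtain b where "?X c p [blinfun_inner_left b] \<noteq> 0"
    unfolding v_def vector_at_def by (metis (no_types, lifting) scaleR_eq_0_iff sum.neutral)
  then obtain bs where bs: "length bs = n - 1" "\<Lambda> c p (map blinfun_inner_left bs @ [blinfun_inner_left b]) \<noteq> 0"
    unfolding sharp_def contract_def by (smt (verit) div_0 mem_Collect_eq mult_eq_0_iff sum.neutral)
  \<comment> \<open>The last slot is fixed at \<open>blinfun_inner_left b\<close>, and the others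
    are pulled back from covectors to vectors. The factor 1 matches the shape of
    \<open>alt_multilinear_map\<close>.\<close>
  define \<omega> where "\<omega> vs = 1 * \<Lambda> c p (map blinfun_inner_left vs @ [blinfun_inner_left b])" for vs
  have \<omega>: "alt_multilinear (n - 1) \<omega>"
    unfolding \<omega>_def
    by (rule alt_multilinear_map[OF alt_multilinear_append[OF \<Lambda>_alt_Suc[OF c]]])
       (rule bounded_linear.linear[OF bounded_linear_blinfun_inner_left])
  have "smooth_on UNIV (\<lambda>x. (x + - snd c p) \<bullet> v)"
    by (intro smooth_on_inner_left smooth_on_add smooth_on_id smooth_on_const) auto
  hence u: "smooth_on UNIV ?u" by simp
  obtain \<beta> V where \<beta>: "\<beta> \<in> forms A (n - 1)" and V: "openin M V" "p \<in> V" "V \<subseteq> chart_dom c"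
    and \<beta>V: "\<And>q vs. q \<in> V \<Longrightarrow> \<beta> c q vs = ?u (snd c q) * \<omega> vs"
    using form_extension[OF c u \<omega>] by blast
  have "((\<lambda>x. ?u x * \<omega> bs) has_derivative (\<lambda>w. (w \<bullet> v) * \<omega> bs)) (at (snd c p))"
    by (auto intro!: derivative_eq_intros)
  hence "(((\<lambda>q. \<beta> c q bs) \<circ> chart_inv c) has_derivative (\<lambda>w. (w \<bullet> v) * \<omega> bs)) (at (snd c p))"
    by (rule has_derivative_in_chart[OF c(1) V(1,3,2), rotated]) (rule \<beta>V)
  hence "chart_deriv c (\<lambda>q. \<beta> c q bs) p = (\<lambda>w. (w \<bullet> v) * \<omega> bs)"
    unfolding chart_deriv_def by (rule frechet_derivative_at[symmetric])
  moreover have "\<beta> c p vs = 0" for vs using \<beta>V[OF V(2)] by simp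
  \<comment> \<open>As \<beta> vanishes at \<open>p\<close>, all that is left of the bracket is the
    derivative of its coefficient along \<open>v\<close>.\<close>
  ultimately have "leibniz_bracket n \<Lambda> \<alpha> \<beta> c p bs = (v \<bullet> v) * \<omega> bs"
    using c by (simp add: leibniz_bracket_def lie_deriv_def v_def)
  moreover have "leibniz_bracket n \<Lambda> \<alpha> \<beta> = zero_field"
    using \<alpha> \<beta> by (simp add: leibniz_center_def)
  ultimately show False using v bs by (simp add: \<omega>_def)
qed

lemma sharp_center_eq_0:
  assumes \<alpha>: "\<alpha> \<in> leibniz_center A n \<Lambda>"
  shows "sharp (n - 1) \<Lambda> \<alpha> = zero_field"
proof (intro ext)
  fix c p and as :: "('e \<Rightarrow>\<^sub>L real) list"
  show "sharp (n - 1) \<Lambda> \<alpha> c p as = 0"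
  proof (cases "(c \<in> A \<and> p \<in> chart_dom c) \<and> length as = 1")
    case True
    then obtain a where "as = [a]" by (auto simp: length_Suc_conv)
    then show ?thesis using sharp_vector_at[of c p \<alpha> a] vector_at_center_eq_0[OF \<alpha>, of c p] True by simp
  next
    case False
    \<comment> \<open>Outside of the atlas \<Lambda> is 0; otherwise the length of \<open>as\<close>
      differs from 1 and \<Lambda> gets a list of length other than \<open>n\<close>, where it is 0
      by convention.\<close>
    have "\<Lambda> c p (map blinfun_inner_left bs @ as) = 0" if "length bs = n - 1" for bs :: "'e list"
    proof (cases "c \<in> A \<and> p \<in> chart_dom c")
      case True
      hence "length (map blinfun_inner_left bs @ as) \<noteq> n" using False that n3 by simp
      thus ?thesis using \<Lambda>_alt[of c p] True unfolding alt_multilinear_def by blast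
    qed (simp add: \<Lambda>_outside)
    then show ?thesis by (simp add: sharp_def contract_def)
  qed
qed

lemma center_eq_kernel: "leibniz_center A n \<Lambda> = sharp_kernel A (n - 1) \<Lambda>"
  using sharp_center_eq_0 leibniz_bracket_eq_0
  unfolding leibniz_center_def sharp_kernel_def by blast

section \<open>The module structure of the kernel\<close>

lemma form_add:
  assumes \<alpha>: "\<alpha> \<in> forms A k" and \<beta>: "\<beta> \<in> forms A k"
  shows "(\<lambda>c p vs. \<alpha> c p vs + \<beta> c p vs) \<in> forms A k"
  unfolding forms_def alt_fields_def mem_Collect_eq
proof (intro conjI allI impI ballI)
  fix c p assume "c \<in> A \<and> p \<in> chart_dom c"
  with formsD(1)[OF \<alpha>, of c p] formsD(1)[OF \<beta>, of c p]
  show "alt_multilinear k (\<lambda>vs. \<alpha> c p vs + \<beta> c p vs)"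
    unfolding alt_multilinear_def by (auto intro: linear_compose_add)
next
  fix c p assume "\<not> (c \<in> A \<and> p \<in> chart_dom c)"
  thus "(\<lambda>vs. \<alpha> c p vs + \<beta> c p vs) = (\<lambda>vs. 0)" using formsD(2)[OF \<alpha>] formsD(2)[OF \<beta>] by simp
next
  fix c c' p vs assume "c \<in> A" "c' \<in> A" "p \<in> chart_dom c \<inter> chart_dom c'"
  thus "\<alpha> c p vs + \<beta> c p vs =
      \<alpha> c' p (map (transition c c' p) vs) + \<beta> c' p (map (transition c c' p) vs)"
    using formsD(3)[OF \<alpha>] formsD(3)[OF \<beta>] by metis
next
  fix c vs assume "c \<in> A"
  thus "smooth_on (chart_image c) (\<lambda>x. \<alpha> c (chart_inv c x) vs + \<beta> c (chart_inv c x) vs)"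
    by (intro smooth_on_add open_image formsD(4)[OF \<alpha>] formsD(4)[OF \<beta>])
qed

text \<open>Smoothness of \<open>h\<close> is expressed in the charts, so that the constant
  \<open>-1\<close> is covered even if the type has points outside of the manifold. It is used for
  negatives.\<close>

lemma form_mult:
  assumes \<alpha>: "\<alpha> \<in> forms A k"
    and h: "\<And>c. c \<in> A \<Longrightarrow> smooth_on (chart_image c) (\<lambda>x. h (chart_inv c x))"
  shows "(\<lambda>c p vs. h p * \<alpha> c p vs) \<in> forms A k"
  unfolding forms_def alt_fields_def mem_Collect_eq
proof (intro conjI allI impI ballI)
  fix c p assume "c \<in> A \<and> p \<in> chart_dom c"
  with alt_multilinear_map[OF formsD(1)[OF \<alpha>, of c p] linear_id, of "h p"]
  show "alt_multilinear k (\<lambda>vs. h p * \<alpha> c p vs)" by simp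
next
  fix c p assume "\<not> (c \<in> A \<and> p \<in> chart_dom c)"
  thus "(\<lambda>vs. h p * \<alpha> c p vs) = (\<lambda>vs. 0)" using formsD(2)[OF \<alpha>] by simp
next
  fix c c' p vs assume "c \<in> A" "c' \<in> A" "p \<in> chart_dom c \<inter> chart_dom c'"
  thus "h p * \<alpha> c p vs = h p * \<alpha> c' p (map (transition c c' p) vs)"
    using formsD(3)[OF \<alpha>] by metis
next
  fix c vs assume "c \<in> A"
  thus "smooth_on (chart_image c) (\<lambda>x. h (chart_inv c x) * \<alpha> c (chart_inv c x) vs)"
    by (intro smooth_on_mult open_image formsD(4)[OF \<alpha>] h)
qed

lemma zero_form: "zero_field \<in> forms A k"
  unfolding forms_def alt_fields_def
  by (auto simp: alt_multilinear_def module_hom_zero intro: smooth_on_const open_image linearI)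

text \<open>The contraction is pointwise linear in the form, so its kernel is closed under sums and
  under multiplication by functions.\<close>

lemma submodule_kernel:
  "submodule (sharp_kernel A k \<Lambda>) (smooth_function_ring M A) (form_module A k)"
proof -
  let ?N = "sharp_kernel A k \<Lambda>" and ?M = "form_module A k"
  have add: "(\<lambda>c p vs. \<alpha> c p vs + \<beta> c p vs) \<in> ?N" if "\<alpha> \<in> ?N" "\<beta> \<in> ?N" for \<alpha> \<beta>
  proof -
    have "sharp k \<Lambda> (\<lambda>c p vs. \<alpha> c p vs + \<beta> c p vs) c p as = sharp k \<Lambda> \<alpha> c p as + sharp k \<Lambda> \<beta> c p as" for c p as
      by (simp add: sharp_def contract_def sum.distrib add_divide_distrib algebra_simps)
    thus ?thesis using that form_add by (simp add: sharp_kernel_def fun_eq_iff)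
  qed
  have mult: "(\<lambda>c p vs. h p * \<alpha> c p vs) \<in> ?N"
    if "\<alpha> \<in> ?N" "\<And>c. c \<in> A \<Longrightarrow> smooth_on (chart_image c) (\<lambda>x. h (chart_inv c x))" for \<alpha> h
  proof -
    have "sharp k \<Lambda> (\<lambda>c p vs. h p * \<alpha> c p vs) c p as = h p * sharp k \<Lambda> \<alpha> c p as" for c p as
      by (simp add: sharp_def contract_def sum_distrib_left mult.assoc)
    thus ?thesis using that form_mult by (simp add: sharp_kernel_def fun_eq_iff)
  qed
  have neg: "(\<lambda>c p vs. - \<alpha> c p vs) \<in> ?N" if "\<alpha> \<in> ?N" for \<alpha>
    using mult[OF that, of "\<lambda>p. - 1"] by (simp add: smooth_on_const open_image)
  have zero: "zero_field \<in> ?N"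
    using zero_form by (simp add: sharp_kernel_def sharp_def contract_def fun_eq_iff)
  \<comment> \<open>\<open>m_inv\<close> is a definite description, so the negative is identified by
    verifying existence and uniqueness.\<close>
  have inv: "inv\<^bsub>add_monoid ?M\<^esub> \<alpha> = (\<lambda>c p vs. - \<alpha> c p vs)" if "\<alpha> \<in> ?N" for \<alpha>
    unfolding m_inv_def
  proof (rule the_equality)
    show "(\<lambda>c p vs. - \<alpha> c p vs) \<in> carrier (add_monoid ?M) \<and>
        \<alpha> \<otimes>\<^bsub>add_monoid ?M\<^esub> (\<lambda>c p vs. - \<alpha> c p vs) = \<one>\<^bsub>add_monoid ?M\<^esub> \<and>
        (\<lambda>c p vs. - \<alpha> c p vs) \<otimes>\<^bsub>add_monoid ?M\<^esub> \<alpha> = \<one>\<^bsub>add_monoid ?M\<^esub>"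
      using neg[OF that] by (simp add: form_module_def sharp_kernel_def)
  next
    fix \<beta> assume "\<beta> \<in> carrier (add_monoid ?M) \<and>
        \<alpha> \<otimes>\<^bsub>add_monoid ?M\<^esub> \<beta> = \<one>\<^bsub>add_monoid ?M\<^esub> \<and> \<beta> \<otimes>\<^bsub>add_monoid ?M\<^esub> \<alpha> = \<one>\<^bsub>add_monoid ?M\<^esub>"
    hence "\<alpha> c p vs + \<beta> c p vs = 0" for c p vs by (cases c) (simp add: form_module_def fun_eq_iff)
    thus "\<beta> = (\<lambda>c p vs. - \<alpha> c p vs)" by (simp add: fun_eq_iff eq_neg_iff_add_eq_0 add.commute)
  qed
  show ?thesis
  proof
    show "?N \<subseteq> carrier (add_monoid ?M)" by (auto simp: form_module_def sharp_kernel_def)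
    show "\<alpha> \<otimes>\<^bsub>add_monoid ?M\<^esub> \<beta> \<in> ?N" if "\<alpha> \<in> ?N" "\<beta> \<in> ?N" for \<alpha> \<beta>
      using add[OF that] by (simp add: form_module_def)
    show "\<one>\<^bsub>add_monoid ?M\<^esub> \<in> ?N" using zero by (simp add: form_module_def)
    show "inv\<^bsub>add_monoid ?M\<^esub> \<alpha> \<in> ?N" if "\<alpha> \<in> ?N" for \<alpha> using inv[OF that] neg[OF that] by simp
    show "h \<odot>\<^bsub>?M\<^esub> \<alpha> \<in> ?N" if "h \<in> carrier (smooth_function_ring M A)" "\<alpha> \<in> ?N" for h \<alpha>
      using mult[OF that(2), of h] that(1)
      by (simp add: form_module_def smooth_function_ring_def smooth_functions_def comp_def)
  qed
qed

end

theorem proposition3p1: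
  fixes M :: "'a topology"
    and A :: "('a, 'e::euclidean_space) chart set"
    and \<Lambda> :: "('a, 'e, 'e \<Rightarrow>\<^sub>L real) field"
    and n :: nat
  assumes "nambu_poisson_manifold M A n \<Lambda>"
    and "n \<ge> 3"
  shows "leibniz_center A n \<Lambda> = sharp_kernel A (n - 1) \<Lambda> \<and>
    submodule (sharp_kernel A (n - 1) \<Lambda>) (smooth_function_ring M A) (form_module A (n - 1))"
proof -
  interpret nambu_poisson M A \<Lambda> n by unfold_locales (fact assms)+
  show ?thesis using center_eq_kernel submodule_kernel by blast
qed

end
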